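(* Let $W$ be the reflection group of type $B_N$ acting in $V=\mathbb{C}^N$, let $m_1,m_2,m_3\in\mathbb{N}$, and let $BCCat$ be the corresponding extended Catalan arrangement of the root system $BC_N$. Then the module $D(BCCat)^W$ is free over the invariants $(SV^* )^W$, and the module $D(BCCat)$ is free over the polynomials $SV^*$.
   Context: $\mathbb{N}=\{0,1,2,\dots\}$. $x_1,\dots,x_N$ are the standard coordinates on $V=\mathbb{C}^N$; $SV^*=\mathbb{C}[x_1,\dots,x_N]$. $W$ is the group of signed permutations of coordinates, acting on $SV^*$ by $(wf)(x)=f(w^{-1}x)$. The numbers $m_1=m(e_i)$, $m_2=m(2e_i)$, $m_3=m(e_i\pm e_j)$ are the values of a $W$-invariant multiplicity function $m$ on the root system $BC_N$ (whose positive half consists of $e_i,2e_i$ and $e_i\pm e_j$, $i<j$). $BCCat$ is the affine arrangement in $V$ with defining polynomial $$P(x)=\prod_{i=1}^N\Big(x_i\prod_{j=1}^{m_1}(x_i^2-j^2)\prod_{j=1}^{m_2}(4x_i^2-(2j-1)^2)\Big)\prod_{i<j}\prod_{\epsilon\in\{\pm1\}}\Big((x_i-\epsilon x_j)\prod_{k=1}^{m_3}((x_i-\epsilon x_j)^2-k^2)\Big).$$ $\mathrm{Der}$ is the module of derivations of $SV^*$, with $W$-action $(wL)(\varphi)=w(L(w^{-1}\varphi))$. $D(BCCat)$ is the $SV^*$-module of $L\in\mathrm{Der}$ such that $L(\ell)\in\ell\,SV^*$ for every degree-one factor $\ell$ of $P$; $D(BCCat)^W$ is its subspace of $W$-invariant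 elements. *)

theory Defs
  imports "HOL-Analysis.Analysis" "HOL-Library.Poly_Mapping" "HOL-Library.Function_Algebras"
begin

section \<open>The polynomial ring \<open>S V\<^sup>* = \<complex>[x\<^sub>1, \<dots>, x\<^sub>N]\<close>\<close>

text \<open>
  \<open>N\<close> is the number of elements of the index type \<open>'n\<close>. A polynomial is a finitely supported map
  from exponent vectors to coefficients; its product is the convolution product of
  \<open>HOL-Library.Poly_Mapping\<close>.
\<close>

type_synonym 'n cpoly = "('n \<Rightarrow>\<^sub>0 nat) \<Rightarrow>\<^sub>0 complex"

definition Const :: "complex \<Rightarrow> 'n cpoly"
  where "Const c = Poly_Mapping.single 0 c"

definition X :: "'n \<Rightarrow> 'n cpoly"
  where "X i = Poly_Mapping.single (Poly_Mapping.single i 1) 1"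

definition total_degree :: "'n::finite cpoly \<Rightarrow> nat"
  where "total_degree f =
    Max (insert 0 ((\<lambda>m. \<Sum>i\<in>UNIV. Poly_Mapping.lookup m i) ` Poly_Mapping.keys f))"

definition insertion ::
    "(complex \<Rightarrow> 'a) \<Rightarrow> ('n::finite \<Rightarrow> 'a) \<Rightarrow> 'n cpoly \<Rightarrow> 'a::comm_ring_1"
  where "insertion h \<sigma> f = (\<Sum>m\<in>Poly_Mapping.keys f.
    h (Poly_Mapping.lookup f m) * (\<Prod>i\<in>UNIV. \<sigma> i ^ Poly_Mapping.lookup m i))"

definition peval :: "complex ^ 'n \<Rightarrow> 'n::finite cpoly \<Rightarrow> complex"
  where "peval v = insertion (\<lambda>c. c) (\<lambda>i. v $ i)"

lemma insertion_superset:
  assumes "finite A" "Poly_Mapping.keys f \<subseteq> A" "h 0 = 0"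
  shows "insertion h \<sigma> f = (\<Sum>m\<in>A.
    h (Poly_Mapping.lookup f m) * (\<Prod>i\<in>UNIV. \<sigma> i ^ Poly_Mapping.lookup m i))"
  unfolding insertion_def
  by (rule sum.mono_neutral_left) (use assms in \<open>auto simp: in_keys_iff\<close>)

lemma insertion_add:
  assumes "h 0 = 0" "\<And>a b. h (a + b) = h a + h b"
  shows "insertion h \<sigma> (f + g) = insertion h \<sigma> f + insertion h \<sigma> g"
proof -
  let ?A = "Poly_Mapping.keys f \<union> Poly_Mapping.keys g"
  show ?thesis
    using Poly_Mapping.keys_add[of f g]
    by (simp add: insertion_superset[of ?A] assms lookup_add sum.distrib distrib_right)
qed

lemma insertion_zero [simp]: "insertion h \<sigma> 0 = 0"
  by (simp add: insertion_def)

lemma insertion_single: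
  assumes "h 0 = 0"
  shows "insertion h \<sigma> (Poly_Mapping.single m c) = h c * (\<Prod>i\<in>UNIV. \<sigma> i ^ Poly_Mapping.lookup m i)"
  by (subst insertion_superset[of "{m}"]) (use assms in auto)

lemma cpoly_induct [case_names zero single add]:
  fixes f :: "'n cpoly"
  assumes "P 0" and "\<And>m c. P (Poly_Mapping.single m c)"
    and "\<And>f g. P f \<Longrightarrow> P g \<Longrightarrow> P (f + g)"
  shows "P f"
proof (induction f rule: Poly_Mapping.update_induct)
  case const
  then show ?case using assms(1) by simp
next
  case (update f a b)
  have "Poly_Mapping.update a b f = f + Poly_Mapping.single a b"
    using update by (intro poly_mapping_eqI)
      (auto simp: lookup_update lookup_add lookup_single in_keys_iff when_def)
  then show ?case using assms update by simp
qed

lemma insertion_mult: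
  assumes h: "h 0 = 0" "\<And>a b. h (a + b) = h a + h b" "\<And>a b. h (a * b) = h a * h b"
  shows "insertion h \<sigma> (f * g) = insertion h \<sigma> f * insertion h \<sigma> g"
proof (induction f rule: cpoly_induct)
  case (single m c)
  show ?case
  proof (induction g rule: cpoly_induct)
    case (single m' c')
    show ?case
      by (simp add: mult_single insertion_single h lookup_add power_add prod.distrib ac_simps)
  qed (simp_all add: distrib_left insertion_add h)
qed (simp_all add: distrib_right insertion_add h)

lemma Const_hom: "Const 0 = 0" "Const (a + b) = Const a + Const b" "Const (a * b) = Const a * Const b"
  "Const 1 = 1"
  by (simp_all add: Const_def single_add mult_single)

lemma peval_hom:
  "peval v (f + g) = peval v f + peval v g"
  "peval v (f * g) = peval v f * peval v g"
  "peval v (Const c) = c"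
  "peval v (X i) = v $ i"
  "peval v 0 = 0"
  "peval v 1 = 1"
proof -
  show "peval v (X i) = v $ i"
    by (simp add: peval_def X_def insertion_single lookup_single when_def if_distrib prod.delta
        cong: if_cong)
  show c: "peval v (Const c) = c" for c
    by (simp add: peval_def Const_def insertion_single)
  show "peval v 1 = 1" using c[of 1] by (simp add: Const_hom)
qed (simp_all add: peval_def insertion_add insertion_mult)

lemma peval_sum: "peval v (sum f A) = (\<Sum>a\<in>A. peval v (f a))"
  by (induction A rule: infinite_finite_induct) (simp_all add: peval_hom)

lemma peval_prod: "peval v (prod f A) = (\<Prod>a\<in>A. peval v (f a))"
  by (induction A rule: infinite_finite_induct) (simp_all add: peval_hom)

lemma peval_power: "peval v (f ^ k) = peval v f ^ k"
  by (induction k) (simp_all add: peval_hom)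


section \<open>The group of type \<open>B\<^sub>N\<close> and its action on polynomials\<close>

definition weyl_B :: "(complex ^ 'n \<Rightarrow> complex ^ 'n::finite) set"
  where "weyl_B = {w. \<exists>\<pi> \<epsilon>. bij \<pi> \<and> (\<forall>i. \<epsilon> i \<in> {1, -1}) \<and> w = (\<lambda>v. \<chi> i. \<epsilon> i * v $ \<pi> i)}"

text \<open>
  The polynomial of \<open>v \<mapsto> f (w\<^sup>-\<^sup>1 v)\<close>, obtained by substituting for \<open>x\<^sub>i\<close> the linear form
  \<open>x\<^sub>i \<circ> w\<^sup>-\<^sup>1\<close>, which is \<open>\<Sum>\<^sub>j x\<^sub>i(w\<^sup>-\<^sup>1 e\<^sub>j) x\<^sub>j\<close>. See lemma \<open>peval_act\<close>.
\<close>

definition act :: "(complex ^ 'n \<Rightarrow> complex ^ 'n) \<Rightarrow> 'n::finite cpoly \<Rightarrow> 'n cpoly"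
  where "act w = insertion Const (\<lambda>i. \<Sum>j\<in>UNIV. Const (inv w (axis j 1) $ i) * X j)"

lemma act_hom:
  "act w (f + g) = act w f + act w g"
  "act w (f * g) = act w f * act w g"
  "act w (Const c) = Const c"
  "act w 0 = 0"
  "act w 1 = 1"
proof -
  show c: "act w (Const c) = Const c" for c
    by (simp add: act_def Const_def insertion_single)
  show "act w 1 = 1" using c[of 1] by (simp add: Const_hom)
qed (simp_all add: act_def insertion_add insertion_mult Const_hom)

lemma act_minus: "act w (- f) = - act w f"
  by (metis act_hom(1,4) add.right_inverse add_eq_0_iff)

lemma weyl_B_inv:
  assumes "w \<in> weyl_B"
  shows "bij w" "inv w \<in> weyl_B"
proof -
  obtain \<pi> \<epsilon> where p: "bij \<pi>" and e: "\<And>i. \<epsilon> i \<in> {1, -1}"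
    and w: "w = (\<lambda>v. \<chi> i. \<epsilon> i * v $ \<pi> i)"
    using assms by (auto simp: weyl_B_def)
  let ?u = "\<lambda>v. \<chi> i. \<epsilon> (inv \<pi> i) * v $ inv \<pi> i"
  have ee: "\<epsilon> i * (\<epsilon> i * c) = c" for i c
    using e[of i] by auto
  have 1: "w \<circ> ?u = id"
    using p by (auto simp: w fun_eq_iff vec_eq_iff ee bij_is_inj inv_f_f)
  have 2: "?u \<circ> w = id"
    using p by (auto simp: w fun_eq_iff vec_eq_iff ee bij_is_surj surj_f_inv_f)
  show "bij w" using 1 2 o_bij by blast
  have "inv w = ?u" using 1 2 by (simp add: inv_unique_comp)
  then show "inv w \<in> weyl_B"
    unfolding weyl_B_def using p e bij_imp_bij_inv
    by (intro CollectI exI[of _ "inv \<pi>"] exI[of _ "\<lambda>i. \<epsilon> (inv \<pi> i)"]) auto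
qed

lemma weyl_B_expand:
  fixes v :: "complex ^ 'n::finite"
  assumes "w \<in> weyl_B"
  shows "(\<Sum>j\<in>UNIV. w (axis j 1) $ i * v $ j) = w v $ i"
proof -
  obtain \<pi> \<epsilon> where w: "w = (\<lambda>v. \<chi> i. \<epsilon> i * v $ \<pi> i)"
    using assms by (auto simp: weyl_B_def)
  show ?thesis
    by (simp add: w axis_def if_distrib if_distribR sum.delta cong: if_cong)
qed

lemma peval_act:
  assumes "w \<in> weyl_B"
  shows "peval v (act w f) = peval (inv w v) f"
proof (induction f rule: cpoly_induct)
  case (single m c)
  show ?case
    by (simp add: act_def insertion_single Const_hom peval_hom peval_prod peval_power peval_sum
        weyl_B_expand[OF weyl_B_inv(2)[OF assms]])
      (simp add: peval_def insertion_single)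
qed (simp_all add: act_hom peval_hom)


section \<open>The invariant ring \<open>(S V\<^sup>*)\<^sup>W\<close>\<close>

typedef 'n inv_cpoly = "{f :: 'n::finite cpoly. \<forall>w\<in>weyl_B. act w f = f}"
  by (rule exI[of _ 0]) (simp add: act_hom)

setup_lifting type_definition_inv_cpoly

instantiation inv_cpoly :: (finite) comm_ring_1
begin

lift_definition zero_inv_cpoly :: "'a inv_cpoly" is 0 by (simp add: act_hom)
lift_definition one_inv_cpoly :: "'a inv_cpoly" is 1 by (simp add: act_hom)
lift_definition plus_inv_cpoly :: "'a inv_cpoly \<Rightarrow> 'a inv_cpoly \<Rightarrow> 'a inv_cpoly" is "(+)"
  by (simp add: act_hom)
lift_definition times_inv_cpoly :: "'a inv_cpoly \<Rightarrow> 'a inv_cpoly \<Rightarrow> 'a inv_cpoly" is "(*)"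
  by (simp add: act_hom)
lift_definition uminus_inv_cpoly :: "'a inv_cpoly \<Rightarrow> 'a inv_cpoly" is uminus
  by (simp add: act_minus)
lift_definition minus_inv_cpoly :: "'a inv_cpoly \<Rightarrow> 'a inv_cpoly \<Rightarrow> 'a inv_cpoly" is "(-)"
  by (simp add: act_hom act_minus diff_conv_add_uminus del: add_uminus_conv_diff)

instance
  by standard (transfer; simp add: algebra_simps)+

end


section \<open>Derivations\<close>

text \<open>
  Derivations live in the additive group of all maps \<open>S V\<^sup>* \<rightarrow> S V\<^sup>*\<close> (pointwise addition,
  from \<open>HOL-Library.Function_Algebras\<close>).
\<close>

type_synonym 'n pmap = "'n cpoly \<Rightarrow> 'n cpoly"

definition derivations :: "'n pmap set"
  where "derivations = {L.
    (\<forall>f g. L (f + g) = L f + L g) \<and>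
    (\<forall>c f. L (Const c * f) = Const c * L f) \<and>
    (\<forall>f g. L (f * g) = f * L g + g * L f)}"

definition der_act :: "(complex ^ 'n \<Rightarrow> complex ^ 'n) \<Rightarrow> 'n::finite pmap \<Rightarrow> 'n pmap"
  where "der_act w L = (\<lambda>\<phi>. act w (L (act (inv w) \<phi>)))"

definition der_scale :: "'n cpoly \<Rightarrow> 'n pmap \<Rightarrow> 'n pmap"
  where "der_scale f L = (\<lambda>\<phi>. f * L \<phi>)"

definition der_scale_inv :: "'n inv_cpoly \<Rightarrow> 'n::finite pmap \<Rightarrow> 'n pmap"
  where "der_scale_inv f = der_scale (Rep_inv_cpoly f)"

lemma module_der_scale: "module der_scale"
  by standard (auto simp: der_scale_def fun_eq_iff algebra_simps)

lemma module_der_scale_inv: "module der_scale_inv"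
  by standard (auto simp: der_scale_inv_def der_scale_def fun_eq_iff algebra_simps
      plus_inv_cpoly.rep_eq times_inv_cpoly.rep_eq one_inv_cpoly.rep_eq)

text \<open>
  Spans are closed under the module operations, so this includes that \<open>M\<close> is a submodule.
\<close>

definition free_submodule :: "('r::comm_ring_1 \<Rightarrow> 'm::ab_group_add \<Rightarrow> 'm) \<Rightarrow> 'm set \<Rightarrow> bool"
  where "free_submodule smul M \<longleftrightarrow>
    module smul \<and> (\<exists>B. \<not> module.dependent smul B \<and> module.span smul B = M)"


section \<open>The extended Catalan arrangement of type \<open>BC\<^sub>N\<close>\<close>

definition BCCat_poly :: "nat \<Rightarrow> nat \<Rightarrow> nat \<Rightarrow> 'n::{finite,linorder} cpoly"
  where "BCCat_poly m\<^sub>1 m\<^sub>2 m\<^sub>3 =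
    (\<Prod>i\<in>UNIV. X i
       * (\<Prod>j=1..m\<^sub>1. X i ^ 2 - of_nat j ^ 2)
       * (\<Prod>j=1..m\<^sub>2. 4 * X i ^ 2 - (2 * of_nat j - 1) ^ 2)) *
    (\<Prod>(i, j)\<in>{(i, j). i < j}. \<Prod>\<epsilon>\<in>{1, -1}.
       (X i - \<epsilon> * X j) * (\<Prod>k=1..m\<^sub>3. (X i - \<epsilon> * X j) ^ 2 - of_nat k ^ 2))"

definition D_BCCat :: "nat \<Rightarrow> nat \<Rightarrow> nat \<Rightarrow> 'n::{finite,linorder} pmap set"
  where "D_BCCat m\<^sub>1 m\<^sub>2 m\<^sub>3 = {L \<in> derivations.
    \<forall>l. total_degree l = 1 \<and> l dvd BCCat_poly m\<^sub>1 m\<^sub>2 m\<^sub>3 \<longrightarrow> l dvd L l}"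

definition D_BCCat_W :: "nat \<Rightarrow> nat \<Rightarrow> nat \<Rightarrow> 'n::{finite,linorder} pmap set"
  where "D_BCCat_W m\<^sub>1 m\<^sub>2 m\<^sub>3 = {L \<in> D_BCCat m\<^sub>1 m\<^sub>2 m\<^sub>3. \<forall>w\<in>weyl_B. der_act w L = L}"

end

theory Submission
  imports Defs "HOL-Computational_Algebra.Polynomial_Factorial"
begin

text \<open>
  For fixed \<open>z\<close>, let \<open>\<Lambda>\<^sub>z\<close> be the moment functional of the Wilson weight in \<open>T = t\<^sup>2\<close> with parameters
  \<open>\<mu> + z, \<mu> - z, a\<^sub>3, a\<^sub>4\<close>, where \<open>\<mu> = (m\<^sub>3 + 1) / 2\<close>, \<open>a\<^sub>3 = m\<^sub>1 - (m\<^sub>3 - 1) / 2\<close>,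
  \<open>a\<^sub>4 = m\<^sub>2 - m\<^sub>3 / 2\<close>, normalised by the product of the forms \<open>z - c\<close> over the hyperplanes
  \<open>x\<^sub>i = c\<close> of the arrangement. It is an algebraic substitute for a discrete integral from \<open>-z\<close> to \<open>z\<close>.
  With \<open>\<beta>\<^sub>w(T) = \<Prod>\<^sub>s ((w + s)\<^sup>2 - T)\<close>, \<open>s\<close> running over \<open>-(m\<^sub>3 - 1) / 2, \<dots>, (m\<^sub>3 - 1) / 2\<close> in unit
  steps, the parameter shifts of the weight give \<open>\<Lambda>\<^sub>z(\<beta>\<^sub>w q) = \<Lambda>\<^sub>w(\<beta>\<^sub>z q)\<close> whenever \<open>z - w\<close> is an
  integer with \<open>|z - w| \<le> m\<^sub>3\<close>. Hence, with \<open>z = x\<^sub>i\<close> and the product taken over \<open>w = x\<^sub>l\<close>, \<open>l \<noteq> i\<close>,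
  the \<open>W\<close>-invariant derivation sending \<open>x\<^sub>i\<close> to \<open>\<Lambda>\<^sub>z(q \<Prod>\<^sub>w \<beta>\<^sub>w)\<close> is logarithmic for every
  \<open>q\<close> with constant coefficients. For \<open>N\<close> such \<open>q\<close> of degrees \<open>0, \<dots>, N - 1\<close> the determinant of the coefficients
  has degree at most that of the arrangement, and at one suitable point it is triangular and nonzero;
  so Saito's criterion applies. An invariant derivation has invariant coefficients in this basis.
\<close>

section \<open>Homomorphisms of the polynomial ring\<close>

text \<open>The Leibniz formula has integer coefficients. Both rings are kept general because this
  serves restriction to a hyperplane as well as the embedding into a field of fractions.\<close>

lemma det_hom:
  fixes h :: "'a::comm_ring_1 \<Rightarrow> 'b::comm_ring_1" and A :: "'a^'n^'n"
  assumes "\<And>x y. h (x + y) = h x + h y" "\<And>x y. h (x * y) = h x * h y" "h 0 = 0" "h 1 = 1"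
  shows "h (det A) = det (\<chi> i j. h (A $ i $ j))"
proof -
  have s: "h (sum f B) = (\<Sum>b\<in>B. h (f b))" for f and B :: "('n \<Rightarrow> 'n) set"
    by (induction B rule: infinite_finite_induct) (simp_all add: assms)
  have p: "h (prod f B) = (\<Prod>b\<in>B. h (f b))" for f and B :: "'n set"
    by (induction B rule: infinite_finite_induct) (simp_all add: assms)
  have n: "h (- x) = - h x" for x
    using assms(1)[of x "- x"] minus_unique[of "h x" "h (- x)"] assms(3) by simp
  have "h (of_nat k) = of_nat k" for k by (induction k) (simp_all add: assms)
  then have "h (of_int k) = of_int k" for k
    by (cases k rule: int_cases2) (simp_all add: n)
  then show ?thesis by (simp add: det_def assms s p)
qed

lemma prod_X_powers:
  "(\<Prod>i\<in>A. X i ^ f i) = Poly_Mapping.single (\<Sum>i\<in>A. Poly_Mapping.single i (f i)) 1"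
proof -
  have pow: "X i ^ k = Poly_Mapping.single (Poly_Mapping.single i k) 1" for i :: 'a and k
    by (induction k) (simp_all add: X_def mult_single single_add[symmetric])
  show ?thesis
    by (induction A rule: infinite_finite_induct) (simp_all add: pow mult_single)
qed

lemma single_conv_X:
  fixes m :: "'n::finite \<Rightarrow>\<^sub>0 nat"
  shows "Poly_Mapping.single m c = Const c * (\<Prod>i\<in>UNIV. X i ^ Poly_Mapping.lookup m i)"
proof -
  have "(\<Sum>i\<in>UNIV. Poly_Mapping.single i (Poly_Mapping.lookup m i)) = m"
    by (intro poly_mapping_eqI)
      (simp add: lookup_sum lookup_single when_def if_distrib sum.delta cong: if_cong)
  then show ?thesis
    by (simp add: prod_X_powers Const_def mult_single)
qed

lemma cpoly_ring_induct [case_names Const X add mult]: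
  fixes f :: "'n::finite cpoly"
  assumes C: "\<And>c. P (Const c)" and X: "\<And>i. P (X i)"
    and add: "\<And>f g. P f \<Longrightarrow> P g \<Longrightarrow> P (f + g)" and mult: "\<And>f g. P f \<Longrightarrow> P g \<Longrightarrow> P (f * g)"
  shows "P f"
proof (induction f rule: cpoly_induct)
  case zero
  then show ?case using C[of 0] by (simp add: Const_hom)
next
  case (single m c)
  have pow: "P (X i ^ k)" for i k
    by (induction k) (use C[of 1] X mult in \<open>auto simp: Const_hom\<close>)
  have "P (\<Prod>i\<in>A. X i ^ Poly_Mapping.lookup m i)" if "finite A" for A
    using that by induction (use C[of 1] pow mult in \<open>auto simp: Const_hom\<close>)
  then show ?case
    by (simp add: single_conv_X C mult)
qed (rule add)

text \<open>These are the complex algebra endomorphisms. Restriction to a hyperplane, the group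
  action and evaluation at a point all have this form, the last by substituting constant
  polynomials.\<close>

definition cpoly_hom :: "('n::finite cpoly \<Rightarrow> 'n cpoly) \<Rightarrow> bool"
  where "cpoly_hom \<psi> \<longleftrightarrow> (\<forall>f g. \<psi> (f + g) = \<psi> f + \<psi> g) \<and> (\<forall>f g. \<psi> (f * g) = \<psi> f * \<psi> g) \<and>
    (\<forall>c. \<psi> (Const c) = Const c)"

lemma cpoly_homD:
  assumes "cpoly_hom \<psi>"
  shows "\<psi> (f + g) = \<psi> f + \<psi> g" "\<psi> (f * g) = \<psi> f * \<psi> g" "\<psi> (Const c) = Const c"
    "\<psi> 0 = 0" "\<psi> 1 = 1" "\<psi> (- f) = - \<psi> f" "\<psi> (f - g) = \<psi> f - \<psi> g" "\<psi> (of_nat k) = of_nat k"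
    "\<psi> (f ^ k) = \<psi> f ^ k"
proof -
  show a: "\<psi> (f + g) = \<psi> f + \<psi> g" and m: "\<psi> (f * g) = \<psi> f * \<psi> g"
    and c: "\<psi> (Const c) = Const c" for f g c
    using assms by (auto simp: cpoly_hom_def)
  show z: "\<psi> 0 = 0" and o: "\<psi> 1 = 1" using c[of 0] c[of 1] by (simp_all add: Const_hom)
  show u: "\<psi> (- f) = - \<psi> f" for f
    using a[of f "- f"] z by (simp add: eq_neg_iff_add_eq_0 add.commute)
  show "\<psi> (f - g) = \<psi> f - \<psi> g" using a[of f "- g"] u by simp
  show "\<psi> (of_nat k) = of_nat k" by (induction k) (simp_all add: a z o)
  show "\<psi> (f ^ k) = \<psi> f ^ k" by (induction k) (simp_all add: o m)
qed

lemma cpoly_hom_sum: "cpoly_hom \<psi> \<Longrightarrow> \<psi> (\<Sum>a\<in>A. f a) = (\<Sum>a\<in>A. \<psi> (f a))"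
  by (induction A rule: infinite_finite_induct) (simp_all add: cpoly_homD)

lemma cpoly_hom_det: "cpoly_hom \<psi> \<Longrightarrow> \<psi> (det A) = det (\<chi> i j. \<psi> (A $ i $ j))"
  by (rule det_hom) (simp_all add: cpoly_homD)

definition subst :: "('n \<Rightarrow> 'n cpoly) \<Rightarrow> 'n::finite cpoly \<Rightarrow> 'n cpoly"
  where "subst \<sigma> = insertion Const \<sigma>"

lemma insertion_X:
  assumes "h 0 = 0" "h 1 = 1"
  shows "insertion h \<sigma> (X i) = \<sigma> i"
  by (simp add: X_def insertion_single assms lookup_single when_def if_distrib prod.delta
      cong: if_cong)

lemma insertion_Const: "h 0 = 0 \<Longrightarrow> insertion h \<sigma> (Const c) = h c"
  by (simp add: Const_def insertion_single)

lemma cpoly_hom_subst: "cpoly_hom (subst \<sigma>)"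
  by (simp add: cpoly_hom_def subst_def insertion_add insertion_mult insertion_Const Const_hom)

lemma subst_X [simp]: "subst \<sigma> (X i) = \<sigma> i"
  by (simp add: subst_def insertion_X Const_hom)

lemma cpoly_hom_act: "cpoly_hom (act w)"
  by (simp add: cpoly_hom_def act_hom)

lemmas subst_simps = cpoly_homD[OF cpoly_hom_subst]

lemma Const_minus: "Const (- a) = - Const a" "Const (a - b) = Const a - Const b"
  by (simp_all add: Const_def single_uminus single_diff)

lemma Const_of_nat: "Const (of_nat k) = of_nat k"
  by (induction k) (simp_all add: Const_hom)

lemma Const_numeral: "Const (numeral k) = numeral k"
  using Const_of_nat[of "numeral k"] by simp

lemma Const_eq_iff [simp]: "Const a = Const b \<longleftrightarrow> a = b"
  by (metis Const_def lookup_single_eq)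

lemma Const_eq_0_iff [simp]: "Const a = 0 \<longleftrightarrow> a = 0"
  by (metis Const_eq_iff Const_hom(1))

section \<open>Degree\<close>

text \<open>
  Replacing \<open>x\<^sub>i\<close> by \<open>s x\<^sub>i\<close> turns the total degree into the degree in \<open>s\<close>, so that the univariate
  degree calculus applies.
\<close>

definition homog :: "'n::finite cpoly \<Rightarrow> 'n cpoly poly"
  where "homog = insertion (\<lambda>c. [:Const c:]) (\<lambda>i. [:0, X i:])"

definition deg :: "'n::finite cpoly \<Rightarrow> nat"
  where "deg f = degree (homog f)"

lemma homog_simps:
  "homog (f + g) = homog f + homog g" "homog (f * g) = homog f * homog g"
  "homog (Const c) = [:Const c:]" "homog (X i) = [:0, X i:]"
  by (simp_all add: homog_def insertion_add insertion_mult insertion_Const insertion_X Const_hom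
      one_pCons)

lemma homog_more_simps: "homog 0 = 0" "homog 1 = 1"
  using homog_simps(3)[of 0] homog_simps(3)[of 1] by (simp_all add: Const_hom one_pCons)

lemma homog_minus: "homog (- f) = - homog f"
  using homog_simps(1)[of f "- f"] minus_unique[of "homog f" "homog (- f)"]
  by (simp add: homog_more_simps)

lemma poly_homog_1: "poly (homog f) 1 = f"
  by (induction f rule: cpoly_ring_induct) (simp_all add: homog_simps)

lemma poly_homog_0: "\<exists>c. poly (homog f) 0 = Const c"
proof (induction f rule: cpoly_ring_induct)
  case (X i)
  show ?case by (intro exI[of _ 0]) (simp add: homog_simps Const_hom)
qed (auto simp: homog_simps Const_hom(2,3)[symmetric])

text \<open>If \<open>homog f\<close> is constant in the scaling variable, its value
  \<open>f\<close> at 1 equals its value at 0, which is a constant.\<close>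

lemma deg_0_imp_Const: "deg f = 0 \<Longrightarrow> \<exists>c. f = Const c"
proof -
  assume "deg f = 0"
  then obtain a where "homog f = [:a:]" by (auto simp: deg_def elim: degree_eq_zeroE)
  then show ?thesis using poly_homog_0[of f] poly_homog_1[of f] by auto
qed

lemma homog_eq_0_iff [simp]: "homog f = 0 \<longleftrightarrow> f = 0"
  by (metis homog_more_simps(1) poly_0 poly_homog_1)

lemma deg_simps [simp]: "deg (Const c) = 0" "deg 0 = 0" "deg 1 = 0" "deg (- f) = deg f"
  by (simp_all add: deg_def homog_simps homog_more_simps homog_minus)

lemma X_nonzero [simp]: "X i \<noteq> 0"
  by (metis X_def lookup_single_eq lookup_zero zero_neq_one)

lemma deg_X [simp]: "deg (X i) = 1"
  by (simp add: deg_def homog_simps)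

lemma deg_add_le: "deg f \<le> n \<Longrightarrow> deg g \<le> n \<Longrightarrow> deg (f + g) \<le> n"
  by (simp add: deg_def homog_simps degree_add_le)

lemma deg_diff_le: "deg f \<le> n \<Longrightarrow> deg g \<le> n \<Longrightarrow> deg (f - g) \<le> n"
  using deg_add_le[of f n "- g"] by simp

lemma deg_mult_le: "deg f \<le> n \<Longrightarrow> deg g \<le> k \<Longrightarrow> deg (f * g) \<le> n + k"
  unfolding deg_def homog_simps using degree_mult_le[of "homog f" "homog g"] by linarith

lemma deg_power_le: "deg f \<le> n \<Longrightarrow> deg (f ^ k) \<le> k * n"
  by (induction k) (simp_all add: deg_mult_le)

lemma deg_prod_le: "(\<And>a. a \<in> A \<Longrightarrow> deg (f a) \<le> n a) \<Longrightarrow> deg (\<Prod>a\<in>A. f a) \<le> (\<Sum>a\<in>A. n a)"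
  by (induction A rule: infinite_finite_induct) (simp_all add: deg_mult_le)

lemma deg_sum_le: "(\<And>a. a \<in> A \<Longrightarrow> deg (f a) \<le> n) \<Longrightarrow> deg (\<Sum>a\<in>A. f a) \<le> n"
  by (induction A rule: infinite_finite_induct) (simp_all add: deg_add_le)

text \<open>The order on the index type orders the exponent vectors, so the polynomial ring has no
  zero divisors and degrees add.\<close>

lemma deg_mult_eq:
  fixes f g :: "'n::{finite,linorder} cpoly"
  shows "f \<noteq> 0 \<Longrightarrow> g \<noteq> 0 \<Longrightarrow> deg (f * g) = deg f + deg g"
  by (simp add: deg_def homog_simps degree_mult_eq)

lemma deg_prod_eq:
  fixes f :: "'a \<Rightarrow> 'n::{finite,linorder} cpoly"
  shows "(\<And>a. a \<in> A \<Longrightarrow> f a \<noteq> 0) \<Longrightarrow> deg (\<Prod>a\<in>A. f a) = (\<Sum>a\<in>A. deg (f a))"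
  by (induction A rule: infinite_finite_induct) (simp_all add: deg_mult_eq)

lemma deg_le_total_degree: "deg f \<le> total_degree f"
proof -
  have 1: "homog (Poly_Mapping.single m c)
      = monom (Poly_Mapping.single m c) (\<Sum>i\<in>UNIV. Poly_Mapping.lookup m i)"
    for m :: "'a \<Rightarrow>\<^sub>0 nat" and c
  proof -
    have p: "(\<Prod>i\<in>A. monom (a i) (b i)) = monom (\<Prod>i\<in>A. a i) (\<Sum>i\<in>A. b i)"
      for A and a :: "'a \<Rightarrow> 'a cpoly" and b
      by (induction A rule: infinite_finite_induct) (simp_all add: mult_monom monom_0 one_pCons)
    have X: "[:0, X i:] = monom (X i) 1" for i :: 'a
      by (simp add: monom_altdef)
    have "homog (Poly_Mapping.single m c)
        = [:Const c:] * (\<Prod>i\<in>UNIV. monom (X i ^ Poly_Mapping.lookup m i) (Poly_Mapping.lookup m i))"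
      by (simp add: homog_def insertion_single Const_hom X monom_power)
    also have "\<dots> = monom (Poly_Mapping.single m c) (\<Sum>i\<in>UNIV. Poly_Mapping.lookup m i)"
      by (simp add: p single_conv_X smult_monom)
    finally show ?thesis .
  qed
  have "degree (insertion (\<lambda>c. [:Const c:]) (\<lambda>i. [:0, X i:]) f) \<le> total_degree f"
    unfolding insertion_def
  proof (intro degree_sum_le)
    fix m assume m: "m \<in> Poly_Mapping.keys f"
    have "(\<Sum>i\<in>UNIV. Poly_Mapping.lookup m i) \<le> total_degree f"
      unfolding total_degree_def using m by (intro Max_ge) auto
    moreover have "[:Const (Poly_Mapping.lookup f m):] * (\<Prod>i\<in>UNIV. [:0, X i:] ^ Poly_Mapping.lookup m i)
      = monom (Poly_Mapping.single m (Poly_Mapping.lookup f m)) (\<Sum>i\<in>UNIV. Poly_Mapping.lookup m i)"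
      using 1[of m "Poly_Mapping.lookup f m"] by (simp add: homog_def insertion_single Const_hom)
    ultimately show "degree ([:Const (Poly_Mapping.lookup f m):]
        * (\<Prod>i\<in>UNIV. [:0, X i:] ^ Poly_Mapping.lookup m i)) \<le> total_degree f"
      using degree_monom_le order_trans by metis
  qed auto
  then show ?thesis by (simp add: deg_def homog_def)
qed

lemma total_degree_le:
  assumes "\<And>m. m \<in> Poly_Mapping.keys f \<Longrightarrow> (\<Sum>i\<in>UNIV. Poly_Mapping.lookup m i) \<le> n"
  shows "total_degree f \<le> n"
  unfolding total_degree_def using assms by (subst Max_le_iff) auto

lemma total_degree_Const [simp]: "total_degree (Const c) = 0"
proof -
  have "total_degree (Const c) \<le> 0"
    by (rule total_degree_le) (auto simp: Const_def split: if_splits)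
  then show ?thesis by simp
qed

lemma deg_eq_1:
  assumes "total_degree f = 1"
  shows "deg f = 1"
  using deg_le_total_degree[of f] deg_0_imp_Const[of f] assms
  by (cases "deg f = 0") auto

section \<open>Divisibility by affine linear forms\<close>

text \<open>
  The quadruple \<open>(i, e, j, k)\<close> encodes the hyperplane \<open>x\<^sub>i = e x\<^sub>j + k\<close>; for \<open>e = 0\<close> the index
  \<open>j\<close> is normalised to \<open>i\<close>.
\<close>

type_synonym 'n hyperplane = "'n \<times> complex \<times> 'n \<times> complex"

definition lin :: "'n hyperplane \<Rightarrow> 'n::finite cpoly"
  where "lin = (\<lambda>(i, e, j, k). X i - Const e * X j - Const k)"

text \<open>Eliminating \<open>X i\<close> models the quotient by \<open>lin h\<close> inside the
  same ring, so that divisibility becomes the vanishing of an image.\<close>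

definition restrict_to :: "'n hyperplane \<Rightarrow> 'n::finite cpoly \<Rightarrow> 'n cpoly"
  where "restrict_to = (\<lambda>(i, e, j, k). subst (X(i := Const e * X j + Const k)))"

text \<open>Fixing \<open>i < j\<close> selects one of the proportional forms of a hyperplane and
  keeps the eliminated variable out of its own replacement when \<open>e\<close> is nonzero.\<close>

definition normal_hp :: "'n::linorder hyperplane \<Rightarrow> bool"
  where "normal_hp = (\<lambda>(i, e, j, k). e = 0 \<and> j = i \<or> e \<in> {1, -1} \<and> i < j)"

lemma cpoly_hom_restrict_to: "cpoly_hom (restrict_to h)"
  by (cases h) (simp add: restrict_to_def cpoly_hom_subst)

lemmas restrict_to_simps = cpoly_homD[OF cpoly_hom_restrict_to]

text \<open>The endomorphism moves each generator by a multiple of \<open>lin h\<close>; a product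
  changes by the usual telescoping sum.\<close>

lemma lin_dvd_diff_restrict: "lin h dvd f - restrict_to h f"
proof (induction f rule: cpoly_ring_induct)
  case (X a)
  obtain i e j k where h: "h = (i, e, j, k)" by (cases h)
  show ?case by (cases "a = i") (simp_all add: h lin_def restrict_to_def algebra_simps)
next
  case (mult f g)
  have "f * g - restrict_to h (f * g)
      = f * (g - restrict_to h g) + restrict_to h g * (f - restrict_to h f)"
    by (simp add: restrict_to_simps algebra_simps)
  then show ?case using mult by (metis dvd_add dvd_mult)
next
  case (add f g)
  have "f + g - restrict_to h (f + g) = (f - restrict_to h f) + (g - restrict_to h g)"
    by (simp add: restrict_to_simps algebra_simps)
  then show ?case using add by (metis dvd_add)
qed (simp add: restrict_to_simps)

lemma lin_dvd_iff:
  assumes "normal_hp h"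
  shows "lin h dvd f \<longleftrightarrow> restrict_to h f = 0"
proof
  obtain i e j k where h: "h = (i, e, j, k)" by (cases h)
  have "restrict_to h (lin h) = 0"
    using assms by (auto simp: h lin_def normal_hp_def subst_simps restrict_to_def Const_hom)
  then show "restrict_to h f = 0" if "lin h dvd f"
    using that by (auto simp: restrict_to_simps)
  show "lin h dvd f" if "restrict_to h f = 0"
    using that lin_dvd_diff_restrict[of h f] by simp
qed

text \<open>\<open>lin h\<close> is prime, since it generates the kernel of a homomorphism into an
  integral domain.\<close>

lemma lin_dvd_mult_iff:
  fixes f g :: "'n::{finite,linorder} cpoly"
  assumes "normal_hp h"
  shows "lin h dvd f * g \<longleftrightarrow> lin h dvd f \<or> lin h dvd g"
  by (simp add: lin_dvd_iff[OF assms] restrict_to_simps)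

lemma peval_minus: "peval v (f - g) = peval v f - peval v g"
  by (metis add_diff_cancel_right' diff_add_cancel peval_hom(1))

lemma peval_lin: "peval v (lin (i, e, j, k)) = v $ i - e * v $ j - k"
  by (simp add: lin_def peval_minus peval_hom)

lemma deg_lin:
  assumes "normal_hp h"
  shows "deg (lin h) = 1"
proof -
  obtain i e j k where h: "h = (i, e, j, k)" by (cases h)
  have "peval (axis i 1) (X i - Const e * X j) \<noteq> 0"
    using assms by (auto simp: h normal_hp_def peval_minus peval_hom axis_def)
  then have 1: "X i - Const e * X j \<noteq> 0" by (auto simp: peval_hom)
  have "lin h = (X i - Const e * X j) + (- Const k)" by (simp add: h lin_def)
  then have "homog (lin h) = homog (X i + - (Const e * X j) + - Const k)" by simp
  also have "\<dots> = [: - Const k, X i - Const e * X j :]"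
    unfolding homog_simps homog_minus by simp
  finally show ?thesis using 1 by (simp add: deg_def)
qed

lemma lin_nonzero: "normal_hp h \<Longrightarrow> lin h \<noteq> 0"
  using deg_lin[of h] by auto

lemma total_degree_lin:
  fixes h :: "'n::{finite,linorder} hyperplane"
  assumes "normal_hp h"
  shows "total_degree (lin h) = 1"
proof -
  obtain i e j k where h: "h = (i, e, j, k)" by (cases h)
  have X: "Poly_Mapping.keys (Const c * X a :: 'n cpoly) \<subseteq> {Poly_Mapping.single a 1}" for a c
    by (auto simp: Const_def X_def mult_single split: if_splits)
  have s: "(\<Sum>b\<in>UNIV. Poly_Mapping.lookup (Poly_Mapping.single a (1::nat)) b) = 1" for a :: 'n
    by (simp add: lookup_single when_def)
  have "lin h = Const 1 * X i + (Const (-e) * X j + Const (-k))"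
    by (simp add: h lin_def Const_minus Const_hom)
  moreover have "Poly_Mapping.keys (Const 1 * X i + (Const (-e) * X j + Const (-k)))
    \<subseteq> {Poly_Mapping.single i 1, Poly_Mapping.single j 1, 0}"
    using Poly_Mapping.keys_add[of "Const 1 * X i" "Const (-e) * X j + Const (-k)"]
      Poly_Mapping.keys_add[of "Const (-e) * X j" "Const (-k)"] X[of 1 i] X[of "-e" j]
    by (auto simp: Const_def split: if_splits)
  ultimately have "total_degree (lin h) \<le> 1"
    using s[of i] s[of j] by (intro total_degree_le) fastforce
  then show ?thesis using deg_le_total_degree[of "lin h"] deg_lin[OF assms] by simp
qed

text \<open>Equal degrees make the cofactor a constant \<open>c\<close>. Evaluation at 0 and at the
  unit vectors compares coefficients, and the normal form forces \<open>c = 1\<close>.\<close>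

lemma lin_dvd_linD:
  fixes h h' :: "'n::{finite,linorder} hyperplane"
  assumes n: "normal_hp h" "normal_hp h'" and "lin h dvd lin h'"
  shows "h = h'"
proof -
  obtain u where u: "lin h' = lin h * u" using assms by blast
  then have "u \<noteq> 0" using lin_nonzero[OF n(2)] by auto
  then have "deg u = 0"
    using u deg_mult_eq[OF lin_nonzero[OF n(1)]] deg_lin n by (metis add_cancel_right_right)
  then obtain c where c: "u = Const c" using deg_0_imp_Const by blast
  obtain i e j k where h: "h = (i, e, j, k)" by (cases h)
  obtain i' e' j' k' where h': "h' = (i', e', j', k')" by (cases h')
  have *: "v $ i' - e' * v $ j' - k' = (v $ i - e * v $ j - k) * c" for v :: "(complex, 'n) vec"
    using arg_cong[OF u, of "peval v"] by (simp add: h h' c peval_lin peval_hom)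
  have k: "k' = k * c" using *[of 0] by simp
  have g: "L - k' = (R - k) * c \<Longrightarrow> L = R * c" for L R
    using k by (simp add: algebra_simps)
  have ax: "axis a 1 $ b = (if a = b then 1 else 0)" for a b :: 'n
    by (simp add: axis_def)
  have **: "(if a = i' then 1 else 0) - e' * (if a = j' then 1 else 0) =
    ((if a = i then 1 else 0) - e * (if a = j then 1 else 0)) * c" for a
    by (rule g) (rule *[of "axis a 1", unfolded ax])
  have c0: "c \<noteq> 0" using \<open>u \<noteq> 0\<close> c by auto
  have i: "i = i'"
    using **[of i] **[of i'] n c0 by (auto simp: h h' normal_hp_def split: if_splits)
  have "c = 1"
    using **[of i'] n by (auto simp: h h' normal_hp_def i split: if_splits)
  then have "e' * (if a = j' then 1 else 0) = e * (if a = j then 1 else 0)" for a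
    using **[of a] i by (auto split: if_splits)
  from this[of j] this[of j'] show ?thesis
    using n i k \<open>c = 1\<close> by (auto simp: h h' normal_hp_def split: if_splits)
qed

text \<open>Distinct normal forms are non-associated primes, so they can be split off one after the
  other.\<close>

lemma prod_lin_dvd:
  fixes f :: "'n::{finite,linorder} cpoly"
  assumes "finite J" "\<And>h. h \<in> J \<Longrightarrow> normal_hp h" "\<And>h. h \<in> J \<Longrightarrow> lin h dvd f"
  shows "(\<Prod>h\<in>J. lin h) dvd f"
  using assms
proof (induction J)
  case (insert h J)
  then have "(\<Prod>h\<in>J. lin h) dvd f" by blast
  then obtain g where g: "f = (\<Prod>h\<in>J. lin h) * g" by (rule dvdE)
  have n: "normal_hp h" using insert by auto
  have "\<not> lin h dvd (\<Prod>h\<in>J'. lin h)" if "finite J'" "J' \<subseteq> J" for J'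
    using that
  proof (induction J')
    case empty
    then show ?case using lin_dvd_iff[OF n, of 1] by (simp add: restrict_to_simps)
  next
    case (insert x J')
    then show ?case
      using lin_dvd_mult_iff[OF n] lin_dvd_linD[OF n, of x] insert.prems \<open>h \<notin> J\<close>
        \<open>\<And>x. x \<in> insert h J \<Longrightarrow> normal_hp x\<close> by auto
  qed
  then have "lin h dvd g"
    using insert.prems(2)[of h] insert.hyps lin_dvd_mult_iff[OF n] by (auto simp: g)
  then show ?case using insert.hyps by (simp add: g mult_dvd_mono mult.commute)
qed simp

text \<open>A prime form on the right divides either \<open>l\<close>, which then is a constant
  multiple of it, or the cofactor \<open>g\<close>, from which it cancels.\<close>

lemma deg_1_dvd_prod_lin:
  fixes l :: "'n::{finite,linorder} cpoly"
  assumes "finite J" "\<And>h. h \<in> J \<Longrightarrow> normal_hp h" "c \<noteq> 0" "deg l = 1"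
    "l * g = Const c * (\<Prod>h\<in>J. lin h)"
  shows "\<exists>h\<in>J. \<exists>u. l = Const u * lin h"
  using assms
proof (induction J arbitrary: g)
  case empty
  then have "l * g = Const c" by simp
  moreover have "l \<noteq> 0" "g \<noteq> 0" using calculation \<open>c \<noteq> 0\<close> by auto
  ultimately show ?case using deg_mult_eq[of l g] \<open>deg l = 1\<close> by simp
next
  case (insert h J)
  have n: "normal_hp h" using insert by auto
  have "lin h dvd l * g" using insert by simp
  then consider "lin h dvd l" | "lin h dvd g" using lin_dvd_mult_iff[OF n] by auto
  then show ?case
  proof cases
    case 1
    then obtain u where u: "l = lin h * u" by blast
    have "u \<noteq> 0" using u \<open>deg l = 1\<close> by auto
    then have "deg u = 0"
      using u deg_mult_eq[OF lin_nonzero[OF n]] deg_lin[OF n] \<open>deg l = 1\<close>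
      by (metis add_cancel_right_right)
    then show ?thesis using u deg_0_imp_Const[of u] by (auto simp: mult.commute)
  next
    case 2
    then obtain g' where g': "g = lin h * g'" by blast
    then have "lin h * (l * g') = lin h * (Const c * (\<Prod>h\<in>J. lin h))"
      using insert by (simp add: ac_simps)
    then have "l * g' = Const c * (\<Prod>h\<in>J. lin h)" using lin_nonzero[OF n] by simp
    then show ?thesis using insert by auto
  qed
qed

section \<open>Wilson moment functionals\<close>

text \<open>Let \<open>v k\<close> be the value of a functional at the Newton product of
  \<open>\<tau> i - T\<close> over \<open>i < k\<close>. Then \<open>mfun \<tau> v M k\<close> is
  its value at that product times all \<open>a - T\<close> with \<open>a\<close> in
  \<open>M\<close>: the recursion expands
  \<open>a - T = (a - \<tau> k) + (\<tau> k - T)\<close>.\<close>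

definition mfun :: "(nat \<Rightarrow> 'a) \<Rightarrow> (nat \<Rightarrow> 'a) \<Rightarrow> 'a multiset \<Rightarrow> nat \<Rightarrow> 'a::comm_ring_1"
  where "mfun \<tau> = fold_mset (\<lambda>a g k. (a - \<tau> k) * g k + g (Suc k))"

lemma mfun_empty [simp]: "mfun \<tau> v {#} = v"
  by (simp add: mfun_def)

lemma mfun_add_mset:
  "mfun \<tau> v (add_mset a M) k = (a - \<tau> k) * mfun \<tau> v M k + mfun \<tau> v M (Suc k)"
proof -
  interpret comp_fun_commute "\<lambda>a g k. (a - \<tau> k) * g k + g (Suc k)"
    by unfold_locales (auto simp: fun_eq_iff algebra_simps)
  show ?thesis by (simp add: mfun_def)
qed

lemma mfun_hom:
  assumes "cpoly_hom \<psi>"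
  shows "\<psi> (mfun \<tau> v M k) = mfun (\<lambda>k. \<psi> (\<tau> k)) (\<lambda>k. \<psi> (v k)) (image_mset \<psi> M) k"
  by (induction M arbitrary: k) (simp_all add: mfun_add_mset cpoly_homD[OF assms])

text \<open>The functional of \<open>v\<close> after multiplication by \<open>b - T\<close> agrees
  with \<open>K\<close> times that of \<open>v'\<close> on the Newton products, and both obey the
  same recursion.\<close>

lemma mfun_shift:
  assumes "\<And>k. (b - \<tau> k) * v k + v (Suc k) = K * v' k"
  shows "mfun \<tau> v (add_mset b M) k = K * mfun \<tau> v' M k"
proof (induction M arbitrary: k)
  case empty
  show ?case using assms by (simp add: mfun_add_mset)
next
  case (add a M)
  have "mfun \<tau> v (add_mset b (add_mset a M)) k
    = (a - \<tau> k) * mfun \<tau> v (add_mset b M) k + mfun \<tau> v (add_mset b M) (Suc k)"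
    by (subst add_mset_commute) (simp only: mfun_add_mset)
  also have "\<dots> = K * mfun \<tau> v' (add_mset a M) k"
    by (simp only: add) (simp add: mfun_add_mset algebra_simps)
  finally show ?case .
qed

text \<open>When the moments beyond \<open>n\<close> vanish, the functional on multiples of the
  \<open>n\<close>-th Newton product is evaluation at \<open>T = \<tau> n\<close>, scaled by
  \<open>v n\<close>.\<close>

lemma mfun_vanish:
  assumes "\<And>k. k > n \<Longrightarrow> v k = 0"
  shows "k > n \<Longrightarrow> mfun \<tau> v M k = 0"
    and "mfun \<tau> v M n = v n * (\<Prod>a\<in>#M. a - \<tau> n)"
proof -
  show 1: "k > n \<Longrightarrow> mfun \<tau> v M k = 0" for k M
    using assms by (induction M arbitrary: k) (simp_all add: mfun_add_mset)
  show "mfun \<tau> v M n = v n * (\<Prod>a\<in>#M. a - \<tau> n)"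
    by (induction M) (simp_all add: mfun_add_mset 1)
qed

lemma deg_mfun:
  assumes "\<And>k. deg (\<tau> k) \<le> 2" "\<And>k. deg (v k) \<le> 2 * k" "\<And>a. a \<in># M \<Longrightarrow> deg a \<le> 2"
  shows "deg (mfun \<tau> v M k) \<le> 2 * size M + 2 * k"
  using assms(3)
proof (induction M arbitrary: k)
  case (add a M)
  have "deg ((a - \<tau> k) * mfun \<tau> v M k) \<le> 2 + (2 * size M + 2 * k)"
    using add assms by (intro deg_mult_le deg_diff_le) auto
  moreover have "deg (mfun \<tau> v M (Suc k)) \<le> 2 * size M + 2 * Suc k"
    using add.IH[of "Suc k"] add.prems by simp
  ultimately show ?case by (simp add: mfun_add_mset deg_add_le)
qed (use assms in auto)

text \<open>It stands for the product of \<open>(a + i)^2 - T\<close> over \<open>i < n\<close>;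
  with multisets of roots, regrouping factors is an equality.\<close>

primrec squares :: "'a \<Rightarrow> nat \<Rightarrow> 'a::comm_ring_1 multiset"
  where "squares a 0 = {#}"
  | "squares a (Suc n) = add_mset (a ^ 2) (squares (a + 1) n)"

lemma squares_add: "squares a (n + k) = squares a n + squares (a + of_nat n) k"
  by (induction n arbitrary: a) (simp_all add: add_ac)

text \<open>The hypothesis says \<open>b + i = - (a + (n - 1 - i))\<close>, so the same squares
  occur in reverse order.\<close>

lemma squares_reflect: "a + b + of_nat n = 1 \<Longrightarrow> squares b n = squares a n"
proof (induction n arbitrary: a)
  case (Suc n)
  have "squares b (Suc n) = squares b n + {#(b + of_nat n) ^ 2#}"
    using squares_add[of b n 1] by simp
  also have "squares b n = squares (a + 1) n" using Suc.prems by (intro Suc.IH) (simp add: algebra_simps)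
  also have "b + of_nat n = - a" using Suc.prems by (simp add: algebra_simps eq_neg_iff_add_eq_0)
  finally show ?case by simp
qed simp

lemma size_squares [simp]: "size (squares a n) = n"
  by (induction n arbitrary: a) simp_all

lemma in_squares_iff: "b \<in># squares a n \<longleftrightarrow> (\<exists>i<n. b = (a + of_nat i) ^ 2)"
proof (induction n arbitrary: a)
  case (Suc n)
  have "(\<exists>i<Suc n. b = (a + of_nat i) ^ 2) \<longleftrightarrow> b = a ^ 2 \<or> (\<exists>i<n. b = (a + of_nat (Suc i)) ^ 2)"
    unfolding Ex_less_Suc2 by simp
  then show ?case using Suc by (simp add: add_ac)
qed simp

lemma image_squares: "cpoly_hom \<psi> \<Longrightarrow> image_mset \<psi> (squares a n) = squares (\<psi> a) n"
  by (induction n arbitrary: a) (simp_all add: cpoly_homD)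

lemma cpoly_hom_pochhammer: "cpoly_hom \<psi> \<Longrightarrow> \<psi> (pochhammer a n) = pochhammer (\<psi> a) n"
  by (induction n) (simp_all add: cpoly_homD pochhammer_Suc)

lemma deg_pochhammer: "deg a \<le> 1 \<Longrightarrow> deg (pochhammer a n) \<le> n"
proof (induction n)
  case (Suc n)
  then have "deg (pochhammer a n * (a + of_nat n)) \<le> n + 1"
    by (intro deg_mult_le deg_add_le) (simp_all flip: Const_of_nat)
  then show ?case by (simp add: pochhammer_Suc)
qed simp

text \<open>
  With \<open>T = t\<^sup>2\<close>, the functional with parameters \<open>a\<^sub>1, \<dots>, a\<^sub>4\<close> and \<open>\<sigma> = a\<^sub>1 + \<dots> + a\<^sub>4\<close> takes
  \<open>\<Prod>\<^sub>i\<^sub><\<^sub>k ((a\<^sub>3 + i)\<^sup>2 - T)\<close> to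
  \<open>(a\<^sub>1 + a\<^sub>3)\<^sub>k (a\<^sub>2 + a\<^sub>3)\<^sub>k (a\<^sub>3 + a\<^sub>4)\<^sub>k / (\<sigma>)\<^sub>k\<close>, the moments of the Wilson weight. Its value at
  \<open>\<Prod>\<^sub>a\<^sub>\<in>\<^sub>M (a - T)\<close> is \<open>wilson a3 a4 s a1 a2 M 0\<close>; a nonzero last argument \<open>k\<close> inserts the product
  above as a further factor.
\<close>

definition wmom :: "complex \<Rightarrow> complex \<Rightarrow> complex \<Rightarrow> 'n cpoly \<Rightarrow> 'n cpoly \<Rightarrow> nat \<Rightarrow> 'n cpoly"
  where "wmom a3 a4 s a1 a2 k = pochhammer (a1 + Const a3) k * pochhammer (a2 + Const a3) k *
    Const (pochhammer (a3 + a4) k / pochhammer s k)"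

definition wilson :: "complex \<Rightarrow> complex \<Rightarrow> complex \<Rightarrow> 'n cpoly \<Rightarrow> 'n cpoly \<Rightarrow> 'n cpoly multiset \<Rightarrow> nat \<Rightarrow>
    'n cpoly"
  where "wilson a3 a4 s a1 a2 = mfun (\<lambda>k. Const ((a3 + of_nat k) ^ 2)) (wmom a3 a4 s a1 a2)"

lemma wilson_commute: "wilson a3 a4 s a1 a2 = wilson a3 a4 s a2 a1"
  by (simp add: wilson_def wmom_def [abs_def] mult.commute)

lemma wilson_hom:
  "cpoly_hom \<psi> \<Longrightarrow> \<psi> (wilson a3 a4 s a1 a2 M k) = wilson a3 a4 s (\<psi> a1) (\<psi> a2) (image_mset \<psi> M) k"
  by (simp add: wilson_def mfun_hom wmom_def [abs_def] cpoly_homD cpoly_hom_pochhammer)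

text \<open>Multiplying the Wilson weight by \<open>a1^2 - T\<close> raises \<open>a1\<close>, and
  with it the sum \<open>s\<close>, by one. The constant in front is the normalised moment of
  \<open>a1^2 - T\<close>.\<close>

lemma wmom_shift:
  assumes s: "a1 + a2 + Const (a3 + a4) = Const s" and s0: "\<And>n. s + of_nat n \<noteq> 0"
  shows "(a1 ^ 2 - Const ((a3 + of_nat k) ^ 2)) * wmom a3 a4 s a1 a2 k + wmom a3 a4 s a1 a2 (Suc k) =
    ((a1 + a2) * (a1 + Const a3) * (a1 + Const a4) * Const (1 / s)) * wmom a3 a4 (s + 1) (a1 + 1) a2 k"
proof -
  define x y P Q where "x = a1 + Const a3" and "y = a2 + Const a3"
    and "P = pochhammer x k" and "Q = pochhammer y k"
  define A where "A = pochhammer (a3 + a4) k"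
  \<comment> \<open>The scalar part common to all three moments; its denominator is that of the
    moment of index \<open>k + 1\<close>.\<close>
  define c where "c = A / (pochhammer s k * (s + of_nat k))"
  have x1: "x * pochhammer (a1 + 1 + Const a3) k = P * (x + of_nat k)"
    using pochhammer_Suc[of x k] pochhammer_rec[of x k] by (simp add: P_def x_def add_ac)
  have nz: "pochhammer s k \<noteq> 0" "pochhammer (s + 1) k \<noteq> 0"
    using s0 by (auto simp: pochhammer_eq_0_iff eq_neg_iff_add_eq_0)
      (metis add.assoc add.commute of_nat_Suc s0)
  have r: "s * pochhammer (s + 1) k = pochhammer s k * (s + of_nat k)"
    using pochhammer_Suc[of s k] pochhammer_rec[of s k] by simp
  have s00: "s \<noteq> 0" using s0[of 0] by simp
  have c1: "A / pochhammer s k = c * (s + of_nat k)"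
    using nz s0[of k] by (simp add: c_def)
  have c2: "pochhammer (a3 + a4) (Suc k) / pochhammer s (Suc k) = c * (a3 + a4 + of_nat k)"
    by (simp add: c_def A_def pochhammer_Suc)
  have c3: "1 / s * (A / pochhammer (s + 1) k) = c"
    by (simp add: c_def r)
  have w: "wmom a3 a4 s a1 a2 k = P * Q * (Const c * (Const s + of_nat k))"
    using c1 by (simp add: wmom_def P_def Q_def A_def x_def y_def Const_hom Const_of_nat)
  have wS: "wmom a3 a4 s a1 a2 (Suc k) = P * (x + of_nat k) * (Q * (y + of_nat k)) *
      (Const c * (Const a3 + Const a4 + of_nat k))"
    unfolding wmom_def c2 by (simp add: P_def Q_def x_def y_def Const_hom Const_of_nat pochhammer_Suc)
  have "((a1 + a2) * (a1 + Const a3) * (a1 + Const a4) * Const (1 / s)) * wmom a3 a4 (s + 1) (a1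
      + 1) a2 k
    = (a1 + a2) * (a1 + Const a4) * (x * pochhammer (a1 + 1 + Const a3) k) * Q *
      (Const (1 / s) * Const (A / pochhammer (s + 1) k))"
    unfolding wmom_def by (simp add: x_def y_def Q_def A_def mult_ac)
  also have "\<dots> = (a1 + a2) * (a1 + Const a4) * (P * (x + of_nat k)) * Q * Const c"
    unfolding x1 Const_hom(3)[symmetric] c3 ..
  finally have R: "((a1 + a2) * (a1 + Const a3) * (a1 + Const a4) * Const (1 / s)) * wmom a3 a4 (s
      + 1) (a1 + 1) a2 k
    = P * Q * Const c * ((a1 + a2) * (a1 + Const a4) * (x + of_nat k))" by (simp only: mult_ac)
  have t: "Const ((a3 + of_nat k) ^ 2) = (Const a3 + of_nat k) ^ 2"
    by (simp add: power2_eq_square Const_hom Const_of_nat)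
  \<comment> \<open>Once the common factors are removed, the claim is this cubic identity.\<close>
  have id: "(a1 ^ 2 - (c3 + n) ^ 2) * (a1 + a2 + (c3 + c4) + n) + (a1 + c3 + n) * (a2 + c3 + n)
      * (c3 + c4 + n)
     = (a1 + a2) * (a1 + c4) * (a1 + c3 + n)" for c3 c4 n :: "'a cpoly"
    by (simp add: algebra_simps power2_eq_square)
  have "(a1 ^ 2 - (Const a3 + of_nat k) ^ 2) * (Const s + of_nat k) +
      (x + of_nat k) * (y + of_nat k) * (Const a3 + Const a4 + of_nat k)
     = (a1 + a2) * (a1 + Const a4) * (x + of_nat k)"
    using id[of "Const a3" "of_nat k" "Const a4"] unfolding x_def y_def s[symmetric] Const_hom(2) .
  then have "P * Q * Const c * ((a1 ^ 2 - (Const a3 + of_nat k) ^ 2) * (Const s + of_nat k) +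
      (x + of_nat k) * (y + of_nat k) * (Const a3 + Const a4 + of_nat k))
     = P * Q * Const c * ((a1 + a2) * (a1 + Const a4) * (x + of_nat k))" by simp
  moreover have "a * (p * q * (d * e)) + p * f * (q * g) * (d * h) = p * q * d * (a * e + f * g * h)"
    for a p q d e f g h :: "'a cpoly"
    by (simp add: algebra_simps)
  ultimately show ?thesis unfolding R w wS t by metis
qed

text \<open>Each step consumes the square \<open>a1^2\<close> and moves on to \<open>a1 + 1\<close>;
  the constants collect into Pochhammer symbols.\<close>

lemma wilson_shift:
  assumes "a1 + a2 + Const (a3 + a4) = Const s" "\<And>n. s + of_nat n \<noteq> 0"
  shows "wilson a3 a4 s a1 a2 (squares a1 n + M) k =
    pochhammer (a1 + a2) n * pochhammer (a1 + Const a3) n * pochhammer (a1 + Const a4) n *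
      Const (1 / pochhammer s n) * wilson a3 a4 (s + of_nat n) (a1 + of_nat n) a2 M k"
  using assms
proof (induction n arbitrary: a1 s)
  case 0
  then show ?case by (simp add: Const_hom)
next
  case (Suc n)
  have *: "wilson a3 a4 s a1 a2 (squares a1 (Suc n) + M) k =
    (a1 + a2) * (a1 + Const a3) * (a1 + Const a4) * Const (1 / s) *
      wilson a3 a4 (s + 1) (a1 + 1) a2 (squares (a1 + 1) n + M) k"
    unfolding wilson_def squares.simps union_mset_add_mset_left
    by (rule mfun_shift) (rule wmom_shift[OF Suc.prems])
  have "s + 1 + of_nat n \<noteq> 0" for n using Suc.prems(2)[of "Suc n"] by (simp add: add_ac)
  moreover have "a1 + 1 + a2 + Const (a3 + a4) = Const (s + 1)"
    using Suc.prems(1) by (simp add: Const_hom add_ac)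
  ultimately have 1: "wilson a3 a4 s a1 a2 (squares a1 (Suc n) + M) k =
    (a1 + a2) * (a1 + Const a3) * (a1 + Const a4) * Const (1 / s) *
    (pochhammer (a1 + 1 + a2) n * pochhammer (a1 + 1 + Const a3) n * pochhammer (a1 + 1 + Const a4) n *
      Const (1 / pochhammer (s + 1) n) * wilson a3 a4 (s + 1 + of_nat n) (a1 + 1 + of_nat n) a2 M k)"
    unfolding * by (subst Suc.IH) simp_all
  have 2: "Const (1 / pochhammer s (Suc n)) = Const (1 / s) * Const (1 / pochhammer (s + 1) n)"
    by (simp add: pochhammer_rec flip: Const_hom(3))
  show ?case
    unfolding 1 2 pochhammer_rec[of "a1 + _"] by (simp only: of_nat_Suc add_ac mult_ac)
qed

section \<open>The functionals attached to a point\<close>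

text \<open>Up to sign, \<open>pochhammer (S + 1 - z) k\<close> consists of the \<open>k\<close>
  factors just below the string from \<open>z - S\<close> to \<open>z + S\<close>. Together they
  form a string starting at \<open>w - S\<close>, which is then cut after \<open>n\<close> factors
  instead.\<close>

lemma pochhammer_strip:
  fixes z S :: "'a::comm_ring_1"
  assumes n: "2 * S + 1 = of_nat n" and z: "z = w + of_nat k"
  shows "pochhammer (z - S) n * pochhammer (S + 1 - z) k =
    (- 1) ^ k * (pochhammer (w - S) n * pochhammer (w + (S + 1)) k)"
proof -
  have "pochhammer (S + 1 - z) k = (- 1) ^ k * pochhammer (w - S) k"
    using pochhammer_minus[of "z - S - 1" k] by (simp add: z algebra_simps)
  moreover have "pochhammer (w - S) k * pochhammer (z - S) n
      = pochhammer (w - S) n * pochhammer (w - S + of_nat n) k"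
    using pochhammer_product'[of "w - S" k n] pochhammer_product'[of "w - S" n k]
    by (simp add: z algebra_simps)
  moreover have "w - S + of_nat n = w + (S + 1)"
    unfolding n[symmetric] by (simp add: algebra_simps)
  ultimately show ?thesis by (simp add: mult_ac)
qed

text \<open>The string of \<open>n\<close> factors from \<open>z - S\<close> to \<open>z + S\<close>
  is symmetric: negating \<open>z\<close> reverses it and changes every sign.\<close>

lemma pochhammer_odd:
  fixes z S :: "'a::comm_ring_1"
  assumes n: "2 * S + 1 = of_nat n"
  shows "pochhammer (- z - S) n = (- 1) ^ n * pochhammer (z - S) n"
proof -
  have 1: "z + S - of_nat n + 1 = z - S" unfolding n[symmetric] by (simp add: algebra_simps)
  have 2: "- z - S = - (z + S)" by simp
  show ?thesis unfolding 2 pochhammer_minus 1 ..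
qed

locale multiplicities =
  fixes m1 m2 m :: nat
begin

definition a3 :: complex where "a3 = of_nat m1 - (of_nat m - 1) / 2"
definition a4 :: complex where "a4 = of_nat m2 - of_nat m / 2"
definition sg :: complex where "sg = of_nat m1 + of_nat m2 + 3 / 2"
definition mu :: complex where "mu = (of_nat m + 1) / 2"
definition h2 :: complex where "h2 = of_nat m2 - 1 / 2"

text \<open>Besides vanishing at the levels of the axial hyperplanes and being odd, this factor
  compensates the Pochhammer symbols that the parameter shifts produce.\<close>

definition axial :: "'n cpoly \<Rightarrow> 'n cpoly"
  where "axial z = pochhammer (z - Const (of_nat m1)) (2 * m1 + 1) * pochhammer (z - Const h2) (2 * m2)"

definition lam :: "'n cpoly \<Rightarrow> 'n cpoly multiset \<Rightarrow> 'n cpoly"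
  where "lam z M = axial z * wilson a3 a4 sg (z + Const mu) (Const mu - z) M 0"

definition beta :: "'n cpoly \<Rightarrow> 'n cpoly multiset"
  where "beta w = squares (w - Const mu + 1) m"

lemma Const_consts:
  "2 * Const (of_nat m1) + 1 = (of_nat (2 * m1 + 1) :: 'n cpoly)"
  "2 * Const h2 + 1 = (of_nat (2 * m2) :: 'n cpoly)"
  "Const mu + Const mu = (of_nat m + 1 :: 'n cpoly)"
  "Const mu + Const a3 = (Const (of_nat m1) + 1 :: 'n cpoly)"
  "Const mu + Const a4 = (Const h2 + 1 :: 'n cpoly)"
  "Const mu + Const mu + Const (a3 + a4) = (Const sg :: 'n cpoly)"
proof -
  have c: "2 * Const c + 1 = (Const (2 * c + 1) :: 'n cpoly)" for c
    by (simp add: Const_hom Const_numeral)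
  have "2 * of_nat m1 + 1 = (of_nat (2 * m1 + 1) :: complex)" "2 * h2 + 1 = of_nat (2 * m2)"
    by (simp_all add: h2_def)
  then show "2 * Const (of_nat m1) + 1 = (of_nat (2 * m1 + 1) :: 'n cpoly)"
    "2 * Const h2 + 1 = (of_nat (2 * m2) :: 'n cpoly)"
    unfolding c by (simp_all only: Const_of_nat)
  have "mu + mu = of_nat m + 1" "mu + a3 = of_nat m1 + 1" "mu + a4 = h2 + 1" "mu + mu + (a3 + a4) = sg"
    by (simp_all add: mu_def a3_def a4_def h2_def sg_def field_simps)
  then show "Const mu + Const mu = (of_nat m + 1 :: 'n cpoly)"
    "Const mu + Const a3 = (Const (of_nat m1) + 1 :: 'n cpoly)"
    "Const mu + Const a4 = (Const h2 + 1 :: 'n cpoly)"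
    "Const mu + Const mu + Const (a3 + a4) = (Const sg :: 'n cpoly)"
    by (metis Const_hom(2,4) Const_of_nat)+
qed

lemma sg_nonzero: "sg + of_nat n \<noteq> 0"
proof
  assume "sg + of_nat n = 0"
  then have "Re (sg + of_nat n) = 0" by simp
  then show False by (simp add: sg_def)
qed

lemma axial_neg: "axial (- z) = - axial z"
  using pochhammer_odd[OF Const_consts(1)[where ?'n = 'a], of z]
    pochhammer_odd[OF Const_consts(2)[where ?'n = 'a], of z]
  by (simp add: axial_def)

text \<open>Negating \<open>z\<close> exchanges the parameters \<open>mu + z\<close> and
  \<open>mu - z\<close>, in which \<open>wilson\<close> is symmetric, while \<open>axial\<close> is
  odd.\<close>

lemma lam_neg: "lam (- z) M = - lam z M"
  unfolding lam_def axial_neg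
  by (subst wilson_commute) (simp add: add.commute)

lemma beta_neg: "beta (- w) = beta w"
  unfolding beta_def
proof (rule squares_reflect)
  have "w - Const mu + 1 + (- w - Const mu + 1) + of_nat m = of_nat m + 2 - (Const mu + Const mu)"
    by (simp add: algebra_simps)
  then show "w - Const mu + 1 + (- w - Const mu + 1) + of_nat m = 1"
    by (simp add: Const_consts)
qed

text \<open>The left factors arise from shifting \<open>mu - z\<close> by \<open>k\<close>, the
  right ones from shifting \<open>w + mu\<close>. Both strings of \<open>axial\<close> are re-cut by
  \<open>pochhammer_strip\<close>, and the two signs cancel.\<close>

lemma axial_strip:
  assumes "z = w + of_nat k"
  shows "axial z * (pochhammer (Const mu - z + Const a3) k * pochhammer (Const mu - z + Const a4) k) =
    axial w * (pochhammer (w + Const mu + Const a3) k * pochhammer (w + Const mu + Const a4) k)"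
proof -
  have 1: "Const mu - z + Const a3 = Const (of_nat m1) + 1 - z" "Const mu - z + Const a4
      = Const h2 + 1 - z"
    "w + Const mu + Const a3 = w + (Const (of_nat m1) + 1)" "w + Const mu + Const a4
        = w + (Const h2 + 1)"
    unfolding Const_consts(4,5)[symmetric] by (simp_all add: algebra_simps)
  have sq: "(- 1) ^ k * (- 1) ^ k = (1 :: 'a cpoly)"
    by (simp flip: power_add mult_2)
  have "axial z * (pochhammer (Const mu - z + Const a3) k * pochhammer (Const mu - z + Const a4) k) =
    (pochhammer (z - Const (of_nat m1)) (2 * m1 + 1) * pochhammer (Const (of_nat m1) + 1 - z) k) *
    (pochhammer (z - Const h2) (2 * m2) * pochhammer (Const h2 + 1 - z) k)"
    unfolding 1 axial_def by (simp only: mult_ac)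
  also have "\<dots> = ((- 1) ^ k * (- 1) ^ k) * (axial w * (pochhammer (w + (Const (of_nat m1) + 1)) k
      * pochhammer (w + (Const h2 + 1)) k))"
    unfolding pochhammer_strip[OF Const_consts(1) assms] pochhammer_strip[OF Const_consts(2) assms]
      axial_def by (simp only: mult_ac)
  finally show ?thesis unfolding 1 sq by simp
qed

text \<open>
  Both sides reduce to the functional with parameters \<open>z + \<mu>\<close> and \<open>\<mu> - w\<close>, by shifting
  \<open>\<mu> - z\<close> on the left and \<open>w + \<mu>\<close> on the right; what remains of \<open>beta w\<close> and \<open>beta z\<close> is
  the same multiset of squares.
\<close>

lemma lam_exchange_nat:
  assumes z: "z = w + of_nat k" and k: "k \<le> m"
  shows "lam z (M + beta w) = lam w (M + beta z)"
proof -
  define n where "n = m - k"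
  have m: "m = n + k" using k by (simp add: n_def)
  have mu2: "Const mu + Const mu = of_nat n + of_nat k + (1 :: 'a cpoly)"
    using Const_consts(3)[where ?'n = 'a] by (simp add: m)
  define p q where "p = squares (- w - Const mu + 1) n" and "q = squares (z - Const mu + 1) n"
  have "q = p" unfolding p_def q_def
  proof (rule squares_reflect)
    have "- w - Const mu + 1 + (z - Const mu + 1) + of_nat n
        = of_nat k + of_nat n + 2 - (Const mu + Const mu)"
      by (simp add: z algebra_simps)
    then show "- w - Const mu + 1 + (z - Const mu + 1) + of_nat n = 1"
      by (simp add: mu2)
  qed
  have "- w - Const mu + 1 + of_nat n = Const mu - z + (of_nat n + of_nat k + 1 - (Const mu + Const mu))"
    "z - Const mu + 1 + of_nat n = w + Const mu + (of_nat n + of_nat k + 1 - (Const mu + Const mu))"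
    by (simp_all add: z algebra_simps)
  then have e: "- w - Const mu + 1 + of_nat n = Const mu - z" "z - Const mu + 1 + of_nat n
      = w + Const mu"
    unfolding mu2 by simp_all
  have sm: "squares a m = squares a n + squares (a + of_nat n) k" for a :: "'a cpoly"
    by (simp add: m[symmetric] flip: squares_add)
  have "beta w = p + squares (Const mu - z) k"
    by (subst beta_neg[symmetric]) (simp only: beta_def sm e p_def)
  then have bw: "M + beta w = squares (Const mu - z) k + (M + p)"
    by simp
  have "beta z = q + squares (w + Const mu) k"
    by (simp only: beta_def sm e q_def)
  then have bz: "M + beta z = squares (w + Const mu) k + (M + p)"
    by (simp add: \<open>q = p\<close>)
  have s: "Const mu - z + (z + Const mu) + Const (a3 + a4) = Const sg"
    "w + Const mu + (Const mu - w) + Const (a3 + a4) = Const sg"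
    using Const_consts(6) by simp_all
  have l: "Const mu - z + (z + Const mu) = Const mu + Const mu" "w + Const mu + (Const mu - w)
      = Const mu + Const mu"
    "Const mu - z + of_nat k = Const mu - w" "w + Const mu + of_nat k = z + Const mu"
    by (simp_all add: z)
  define C where "C = pochhammer (Const mu + Const mu :: 'a cpoly) k * Const (1 / pochhammer sg k) *
    wilson a3 a4 (sg + of_nat k) (z + Const mu) (Const mu - w) (M + p) 0"
  have "lam z (M + beta w) = axial z * (pochhammer (Const mu - z + Const a3) k
      * pochhammer (Const mu - z + Const a4) k) * C"
    unfolding lam_def wilson_commute[of _ _ _ "z + Const mu"] bw wilson_shift[OF s(1) sg_nonzero] l C_def
    unfolding wilson_commute[of _ _ _ "z + Const mu"] by (simp only: mult_ac)
  also have "\<dots> = axial w * (pochhammer (w + Const mu + Const a3) k * pochhammer (w + Const mu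
      + Const a4) k) * C"
    unfolding axial_strip[OF z] ..
  also have "\<dots> = lam w (M + beta z)"
    unfolding lam_def bz wilson_shift[OF s(2) sg_nonzero] l C_def by (simp only: mult_ac)
  finally show ?thesis .
qed

lemma lam_exchange:
  assumes "z = w + of_int k" "\<bar>k\<bar> \<le> int m"
  shows "lam z (M + beta w) = lam w (M + beta z)"
proof (cases "k \<ge> 0")
  case True
  then show ?thesis using assms by (intro lam_exchange_nat[of z w "nat k"]) auto
next
  case False
  then show ?thesis using assms
    by (intro lam_exchange_nat[of w z "nat (- k)", symmetric]) (auto simp: nat_le_iff)
qed

lemma axial_hom: "cpoly_hom \<psi> \<Longrightarrow> \<psi> (axial z) = axial (\<psi> z)"
  by (simp add: axial_def cpoly_homD cpoly_hom_pochhammer)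

lemma lam_hom: "cpoly_hom \<psi> \<Longrightarrow> \<psi> (lam z M) = lam (\<psi> z) (image_mset \<psi> M)"
  by (simp add: lam_def axial_hom cpoly_homD wilson_hom)

lemma beta_hom: "cpoly_hom \<psi> \<Longrightarrow> image_mset \<psi> (beta z) = beta (\<psi> z)"
  by (simp add: beta_def image_squares cpoly_homD)

lemma deg_lam:
  assumes "deg z \<le> 1" "\<And>a. a \<in># M \<Longrightarrow> deg a \<le> 2"
  shows "deg (lam z M) \<le> 2 * m1 + 2 * m2 + 1 + 2 * size M"
proof -
  have "deg (axial z) \<le> (2 * m1 + 1) + 2 * m2"
    unfolding axial_def using assms by (intro deg_mult_le deg_pochhammer deg_diff_le) auto
  moreover have "deg (wmom a3 a4 sg (z + Const mu) (Const mu - z) k) \<le> (k + k) + 0" for k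
    unfolding wmom_def using assms by (intro deg_mult_le deg_pochhammer deg_add_le deg_diff_le) auto
  then have "deg (wilson a3 a4 sg (z + Const mu) (Const mu - z) M 0) \<le> 2 * size M + 2 * 0"
    unfolding wilson_def using assms by (intro deg_mfun) (simp_all add: mult_2)
  ultimately have "deg (lam z M) \<le> (2 * m1 + 1 + 2 * m2) + (2 * size M + 2 * 0)"
    unfolding lam_def by (intro deg_mult_le)
  then show ?thesis by simp
qed

lemma deg_in_beta:
  assumes "deg w \<le> 1" "a \<in># beta w"
  shows "deg a \<le> 2"
proof -
  obtain i where "a = (w - Const mu + 1 + of_nat i) ^ 2"
    using assms by (auto simp: beta_def in_squares_iff)
  moreover have "deg (w - Const mu + 1 + of_nat i) \<le> 1"
    using assms by (intro deg_add_le deg_diff_le) (simp_all flip: Const_of_nat)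
  ultimately show ?thesis using deg_power_le[of _ 1 2] by auto
qed

lemma size_beta [simp]: "size (beta w) = m"
  by (simp add: beta_def)

section \<open>Values of the functionals at suitable integers\<close>

definition tau :: "nat \<Rightarrow> 'n cpoly"
  where "tau n = Const ((a3 + of_nat n) ^ 2)"

text \<open>Apart from \<open>n = k\<close>, equal squares would need
  \<open>n + k = m - 2 * m1 - 1\<close>, which is impossible once \<open>n\<close> exceeds
  \<open>m\<close>.\<close>

lemma tau_inj:
  assumes "n \<ge> m + 1 + k" 
  shows "tau n \<noteq> (tau k :: 'n cpoly)"
proof
  assume "tau n = (tau k :: 'n cpoly)"
  then have "(a3 + of_nat n) ^ 2 = (a3 + of_nat k) ^ 2" by (simp add: tau_def)
  then have "(of_nat n - of_nat k :: complex) * (2 * a3 + of_nat n + of_nat k) = 0"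
    by (simp add: algebra_simps power2_eq_square)
  moreover have "(of_nat n - of_nat k :: complex) \<noteq> 0" using assms by simp
  ultimately have "Re (2 * a3 + of_nat n + of_nat k) = 0" by simp
  then have "real (2 * m1 + 1 + n + k) = real m" by (simp add: a3_def field_simps)
  then have "2 * m1 + 1 + n + k = m" by linarith
  then show False using assms by simp
qed

text \<open>\<open>a3 + a4\<close> is an integer plus one half, so no factor vanishes.\<close>

lemma a34_nonzero: "pochhammer (a3 + a4) n \<noteq> 0"
proof
  assume "pochhammer (a3 + a4) n = 0"
  then obtain i where "a3 + a4 = - of_nat i" by (auto simp: pochhammer_eq_0_iff)
  then have "Re (2 * (a3 + a4)) = Re (2 * (- of_nat i))" by simp
  then have "2 * real_of_int (int m1 + int m2 - int m + int i) + 1 = 0"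
    by (simp add: a3_def a4_def field_simps)
  then have "real_of_int (2 * (int m1 + int m2 - int m + int i) + 1) = of_int 0" by simp
  then show False unfolding of_int_eq_iff by presburger
qed

text \<open>At this \<open>z\<close> the combination \<open>mu - z + a3\<close> equals
  \<open>- J\<close>, so the moments stop at \<open>J\<close>. The factors
  \<open>squares (Const a3) J\<close> form the \<open>J\<close>-th Newton product, behind which the
  functional is a nonzero multiple of evaluation at \<open>tau J\<close>.\<close>

lemma lam_at_node:
  fixes M :: "'n::{finite,linorder} cpoly multiset"
  assumes z: "z = of_nat (m1 + 1 + J)"
  shows "lam z (squares (Const a3) J + add_mset (tau J) M) = 0"
    and "\<forall>a\<in>#M. a \<noteq> tau J \<Longrightarrow> lam z (squares (Const a3) J + M) \<noteq> 0"
proof -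
  define v :: "nat \<Rightarrow> 'n cpoly" where "v = wmom a3 a4 sg (z + Const mu) (Const mu - z)"
  have j: "Const mu - z + Const a3 = - of_nat J" "z + Const mu + Const a3 = of_nat (2 * m1 + 2 + J)"
    using Const_consts(4)[where ?'n = 'n] by (simp_all add: z algebra_simps flip: Const_of_nat)
      (simp_all add: Const_hom Const_numeral algebra_simps)
  have v: "v k = pochhammer (of_nat (2 * m1 + 2 + J)) k * pochhammer (- of_nat J) k *
      Const (pochhammer (a3 + a4) k / pochhammer sg k)" for k
    by (simp only: v_def wmom_def j)
  have v0: "v k = 0" if "k > J" for k
    using that by (simp add: v pochhammer_of_nat_eq_0_lemma)
  have sgp: "pochhammer sg k \<noteq> 0" for k
    using sg_nonzero by (auto simp: pochhammer_eq_0_iff eq_neg_iff_add_eq_0)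
  have "pochhammer (2 * m1 + 2 + J) k \<noteq> 0" for k
    using pochhammer_pos[of "2 * m1 + 2 + J" k] by simp
  then have "pochhammer (of_nat (2 * m1 + 2 + J)) k \<noteq> (0 :: 'n cpoly)" for k
    by (simp only: pochhammer_of_nat of_nat_eq_0_iff not_False_eq_True)
  then have vJ: "v J \<noteq> 0"
    using pochhammer_of_nat_eq_0_lemma'[of J J, where ?'a = "'n cpoly"] a34_nonzero sgp by (simp add: v)
  have sq: "mfun tau v (squares (Const a3 + of_nat k) n + M) k = mfun tau v M (k + n)"
      for k n and M :: "'n cpoly multiset"
  proof (induction n arbitrary: k)
    case (Suc n)
    have "tau k = (Const a3 + of_nat k :: 'n cpoly) ^ 2"
      by (simp add: tau_def power2_eq_square Const_hom Const_of_nat)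
    then show ?case using Suc[of "Suc k"] by (simp add: mfun_add_mset add_ac)
  qed simp
  have w: "wilson a3 a4 sg (z + Const mu) (Const mu - z) = mfun tau v"
    by (simp add: wilson_def v_def tau_def [abs_def])
  have l: "lam z (squares (Const a3) J + M) = axial z * (v J * (\<Prod>a\<in>#M. a - tau J))" for M
    using sq[of 0 J M] by (simp add: lam_def w mfun_vanish(2) v0)
  show "lam z (squares (Const a3) J + add_mset (tau J) M) = 0" unfolding l by simp
  have pz: "pochhammer (z - Const c) n \<noteq> 0" if "\<And>i. i < n \<Longrightarrow> of_nat (m1 + 1 + J) - c + of_nat i \<noteq> 0"
      for c n
  proof -
    have "(z - Const c + of_nat i) \<noteq> 0" if "i < n" for i
    proof -
      have "z - Const c + of_nat i = Const (of_nat (m1 + 1 + J) - c + of_nat i)"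
        by (simp only: z Const_hom Const_minus Const_of_nat)
      then show ?thesis using \<open>\<And>i. i < n \<Longrightarrow> of_nat (m1 + 1 + J) - c + of_nat i \<noteq> 0\<close>[OF that] by simp
    qed
    then show ?thesis by (simp add: pochhammer_prod)
  qed
  have "axial z \<noteq> 0"
  proof -
    have "of_nat (m1 + 1 + J) - of_nat m1 + of_nat i \<noteq> (0 :: complex)" for i
    proof
      assume "of_nat (m1 + 1 + J) - of_nat m1 + of_nat i = (0 :: complex)"
      then have "of_nat (1 + J + i) = (0 :: complex)" by (simp add: add_ac)
      then show False unfolding of_nat_eq_0_iff by simp
    qed
    moreover have "of_nat (m1 + 1 + J) - h2 + of_nat i \<noteq> (0 :: complex)" for i
    proof
      assume "of_nat (m1 + 1 + J) - h2 + of_nat i = (0 :: complex)"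
      then have "Re (2 * (of_nat (m1 + 1 + J) - h2 + of_nat i)) = 0" by simp
      then have "real_of_int (2 * (int m1 + 1 + int J - int m2 + int i) + 1) = of_int 0"
        by (simp add: h2_def)
      then show False unfolding of_int_eq_iff by presburger
    qed
    ultimately show ?thesis by (simp add: axial_def pz)
  qed
  then show "\<forall>a\<in>#M. a \<noteq> tau J \<Longrightarrow> lam z (squares (Const a3) J + M) \<noteq> 0"
    using vJ by (auto simp: l prod_mset_zero_iff)
qed

end

section \<open>Derivations\<close>

text \<open>\<open>L\<close> is a derivation iff \<open>f \<mapsto> f + s L(f)\<close> is multiplicative modulo \<open>s\<^sup>2\<close>.\<close>

definition der_of :: "('n \<Rightarrow> 'n cpoly) \<Rightarrow> 'n::finite pmap"
  where "der_of v f = coeff (insertion (\<lambda>c. [:Const c:]) (\<lambda>i. [:X i, v i:]) f) 1"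

lemma derivationsD:
  assumes "L \<in> derivations"
  shows "L (f + g) = L f + L g" "L (f * g) = f * L g + g * L f" "L (Const c * f) = Const c * L f"
    "L (Const c) = 0"
proof -
  show "L (f + g) = L f + L g" and m: "L (f * g) = f * L g + g * L f"
    and c: "L (Const c * f) = Const c * L f" for f g c
    using assms by (auto simp: derivations_def)
  have "L 1 = 0" using m[of 1 1] by simp
  then show "L (Const c) = 0" using c[of c 1] by simp
qed

lemma derivations_eqI:
  fixes L L' :: "'n::finite pmap"
  assumes "L \<in> derivations" "L' \<in> derivations" "\<And>i. L (X i) = L' (X i)"
  shows "L = L'"
proof
  show "L f = L' f" for f
    by (induction f rule: cpoly_ring_induct) (simp_all add: assms derivationsD)
qed

lemma der_of_derivation: "der_of v \<in> derivations"
proof -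
  let ?h = "insertion (\<lambda>c. [:Const c:]) (\<lambda>i. [:X i, v i:])"
  have h: "?h (f + g) = ?h f + ?h g" "?h (f * g) = ?h f * ?h g" "?h (Const c) = [:Const c:]" for f g c
    by (simp_all add: insertion_add insertion_mult insertion_Const Const_hom)
  have 0: "coeff (?h f) 0 = f" for f
    by (induction f rule: cpoly_ring_induct)
      (simp_all add: h insertion_X Const_hom one_pCons coeff_mult)
  show ?thesis
    unfolding derivations_def der_of_def by (simp add: h 0 coeff_mult algebra_simps)
qed

lemma der_of_X [simp]: "der_of v (X i) = v i"
  by (simp add: der_of_def insertion_X Const_hom one_pCons)

lemma derivation_lin:
  assumes "L \<in> derivations"
  shows "L (lin (i, e, j, k)) = L (X i) - Const e * L (X j)"
proof -
  have "lin (i, e, j, k) = X i + (Const (- e) * X j + Const (- k))"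
    by (simp add: lin_def Const_minus)
  then show ?thesis by (simp only: derivationsD(1,3,4)[OF assms]) (simp add: Const_minus)
qed

lemma der_comb_apply: "(\<Sum>r\<in>A. der_scale (g r) (L r)) f = (\<Sum>r\<in>A. g r * L r f)"
  by (induction A rule: infinite_finite_induct) (simp_all add: der_scale_def)

lemma derivation_comb:
  fixes L :: "'a \<Rightarrow> 'n::finite pmap"
  assumes "\<And>r. r \<in> A \<Longrightarrow> L r \<in> derivations"
  shows "(\<Sum>r\<in>A. der_scale (g r) (L r)) \<in> derivations"
  unfolding derivations_def mem_Collect_eq der_comb_apply
proof (intro conjI allI)
  fix f h :: "'n cpoly" and c
  show "(\<Sum>r\<in>A. g r * L r (f + h)) = (\<Sum>r\<in>A. g r * L r f) + (\<Sum>r\<in>A. g r * L r h)"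
    unfolding sum.distrib[symmetric]
    by (intro sum.cong refl) (simp only: derivationsD(1)[OF assms] distrib_left)
  show "(\<Sum>r\<in>A. g r * L r (Const c * f)) = Const c * (\<Sum>r\<in>A. g r * L r f)"
    unfolding sum_distrib_left
    by (intro sum.cong refl) (simp only: derivationsD(3)[OF assms] mult.left_commute)
  show "(\<Sum>r\<in>A. g r * L r (f * h)) = f * (\<Sum>r\<in>A. g r * L r h) + h * (\<Sum>r\<in>A. g r * L r f)"
    unfolding sum_distrib_left sum.distrib[symmetric]
    by (intro sum.cong refl) (simp only: derivationsD(2)[OF assms] distrib_left mult.left_commute)
qed

text \<open>Passes from a family indexed by \<open>'n\<close> to a basis as a set: independence
  makes the family injective, so sums over its range are sums over the index.\<close>

lemma free_submoduleI:
  fixes smul :: "'r::comm_ring_1 \<Rightarrow> 'm::ab_group_add \<Rightarrow> 'm" and \<theta> :: "'n::finite \<Rightarrow> 'm"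
  assumes "module smul"
    and indep: "\<And>g r. (\<Sum>r\<in>UNIV. smul (g r) (\<theta> r)) = 0 \<Longrightarrow> g r = 0"
    and M: "M = range (\<lambda>g. \<Sum>r\<in>UNIV. smul (g r) (\<theta> r))"
  shows "free_submodule smul M"
proof -
  interpret module smul by fact
  have inj: "inj \<theta>"
  proof (rule injI, rule ccontr)
    fix r s assume rs: "\<theta> r = \<theta> s" "r \<noteq> s"
    define g :: "'n \<Rightarrow> 'r" where "g = (\<lambda>t. (if t = r then 1 else 0) - (if t = s then 1 else 0))"
    have "(\<Sum>t\<in>UNIV. smul (g t) (\<theta> t)) = \<theta> r - \<theta> s"
    proof -
      have "smul (g t) (\<theta> t) = (if t = r then \<theta> t else 0) - (if t = s then \<theta> t else 0)" for t
        by (simp add: g_def scale_left_diff_distrib)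
      then show ?thesis by (simp add: sum_subtractf)
    qed
    then have "g r = 0" using rs indep by simp
    then show False using rs by (simp add: g_def)
  qed
  have "independent (range \<theta>)"
    unfolding independent_explicit_module
  proof (intro allI impI)
    fix t u v
    assume t: "finite t" "t \<subseteq> range \<theta>" "(\<Sum>v\<in>t. smul (u v) v) = 0" "v \<in> t"
    define g where "g = (\<lambda>r. if \<theta> r \<in> t then u (\<theta> r) else 0)"
    have "(\<Sum>r\<in>UNIV. smul (g r) (\<theta> r)) = (\<Sum>r\<in>\<theta> -` t. smul (u (\<theta> r)) (\<theta> r))"
      by (intro sum.mono_neutral_cong_right) (auto simp: g_def)
    also have "\<dots> = (\<Sum>v\<in>\<theta> ` (\<theta> -` t). smul (u v) v)"
      using inj by (subst sum.reindex) (auto simp: inj_on_def)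
    also have "\<theta> ` (\<theta> -` t) = t" using t by auto
    finally have g: "g r = 0" for r using t indep by simp
    obtain r where "v = \<theta> r" using t by auto
    then show "u v = 0" using g[of r] t by (simp add: g_def)
  qed
  moreover have "span (range \<theta>) = M"
  proof
    have "span (range \<theta>) = range (\<lambda>u. \<Sum>v\<in>range \<theta>. smul (u v) v)"
      by (rule span_finite) simp
    also have "\<dots> \<subseteq> M"
    proof
      fix x assume "x \<in> range (\<lambda>u. \<Sum>v\<in>range \<theta>. smul (u v) v)"
      then obtain u where "x = (\<Sum>v\<in>range \<theta>. smul (u v) v)" by blast
      then have "x = (\<Sum>r\<in>UNIV. smul (u (\<theta> r)) (\<theta> r))"
        using inj by (simp add: sum.reindex)
      then show "x \<in> M" unfolding M by (intro range_eqI[of _ _ "\<lambda>r. u (\<theta> r)"])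
    qed
    finally show "span (range \<theta>) \<subseteq> M" .
    show "M \<subseteq> span (range \<theta>)"
    proof
      fix x assume "x \<in> M"
      then obtain g where "x = (\<Sum>r\<in>UNIV. smul (g r) (\<theta> r))" unfolding M by blast
      then show "x \<in> span (range \<theta>)" by (simp only:) (intro span_sum span_scale span_base rangeI)
    qed
  qed
  ultimately show ?thesis unfolding free_submodule_def using assms(1) by blast
qed

section \<open>Determinants over integral domains\<close>

lemma to_fract_sum: "to_fract (sum f A) = (\<Sum>a\<in>A. to_fract (f a))"
  by (induction A rule: infinite_finite_induct) simp_all

lemma det_to_fract: "to_fract (det A) = det (\<chi> i j. to_fract (A $ i $ j))"
  by (rule det_hom) simp_all

text \<open>Cramer's rule over the field of fractions, multiplied through by the determinant so that
  it can be read in the ring.\<close>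

lemma cramer_idom:
  fixes A :: "'a::idom^'n^'n"
  assumes nz0: "det A \<noteq> 0"
  shows "det A * b i = (\<Sum>r\<in>UNIV. det (\<chi> i j. if j = r then b i else A $ i $ j) * A $ i $ r)"
proof -
  define B where "B = (\<chi> i j. to_fract (A $ i $ j))"
  have B: "det B = to_fract (det A)" by (simp add: B_def det_to_fract)
  then have nz: "det B \<noteq> 0" using nz0 by simp
  have "B *v (\<chi> k. det (\<chi> i j. if j = k then (\<chi> i. to_fract (b i)) $ i else B $ i $ j) / det B)
      = (\<chi> i. to_fract (b i))"
    using cramer[OF nz] by blast
  then have 1: "(\<Sum>r\<in>UNIV. B $ i $ r * (det (\<chi> i j. if j
      = r then to_fract (b i) else B $ i $ j) / det B)) = to_fract (b i)"
    unfolding matrix_vector_mult_def vec_eq_iff vec_lambda_beta by blast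
  have 2: "det (\<chi> i j. if j = r then to_fract (b i) else B $ i $ j) =
      to_fract (det (\<chi> i j. if j = r then b i else A $ i $ j))" for r
    unfolding det_to_fract by (intro arg_cong[of _ _ det]) (simp add: vec_eq_iff B_def)
  have Bi: "B $ i $ r = to_fract (A $ i $ r)" for r by (simp add: B_def)
  have "to_fract (det A * b i) = det B * to_fract (b i)" by (simp add: B)
  also have "\<dots> = (\<Sum>r\<in>UNIV. det B * (B $ i $ r * (to_fract (det (\<chi> i j. if j
      = r then b i else A $ i $ j)) / det B)))"
    by (subst 1[symmetric]) (simp only: 2 sum_distrib_left)
  also have "\<dots> = (\<Sum>r\<in>UNIV. to_fract (det (\<chi> i j. if j = r then b i else A $ i $ j) * A $ i $ r))"
    using nz by (intro sum.cong refl) (simp add: Bi)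
  finally show ?thesis by (simp only: to_fract_sum[symmetric] to_fract_eq_iff)
qed

lemma det_nonzero_kernel:
  fixes A :: "'a::idom^'n^'n"
  assumes "det A \<noteq> 0" "\<And>i. (\<Sum>r\<in>UNIV. g r * A $ i $ r) = 0"
  shows "g r = 0"
proof -
  define B where "B = (\<chi> i j. to_fract (A $ i $ j))"
  have nz: "det B \<noteq> 0" using assms by (simp add: B_def det_to_fract[symmetric])
  have "(\<Sum>r\<in>UNIV. B $ i $ r * to_fract (g r)) = to_fract (\<Sum>r\<in>UNIV. g r * A $ i $ r)" for i
    unfolding to_fract_sum by (intro sum.cong refl) (simp add: B_def)
  then have 1: "B *v (\<chi> r. to_fract (g r)) = 0"
    unfolding assms(2) matrix_vector_mult_def vec_eq_iff by simp
  have 2: "B *v 0 = 0" by simp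
  have "(\<chi> r. to_fract (g r)) = 0"
    using iffD1[OF cramer[OF nz] 1] iffD1[OF cramer[OF nz] 2] by (rule trans[OF _ sym])
  then have "to_fract (g r) = 0" by (simp add: vec_eq_iff)
  then show ?thesis by simp
qed

text \<open>Only the identity contributes, since every other permutation has some
  \<open>i < p i\<close>.\<close>

lemma det_triangular:
  fixes A :: "(('a::comm_ring_1, 'n::{finite,linorder}) vec, 'n) vec"
  assumes "\<And>i r. i < r \<Longrightarrow> A $ i $ r = 0"
  shows "det A = (\<Prod>i\<in>UNIV. A $ i $ i)"
proof -
  have "(\<Prod>i\<in>UNIV. A $ i $ p i) = 0" if p: "p permutes UNIV" "p \<noteq> id" for p
  proof -
    have "\<exists>i. i < p i"
    proof (rule ccontr)
      assume "\<nexists>i. i < p i"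
      then have le: "p i \<le> i" for i by (simp add: not_less)
      \<comment> \<open>If no index moves up, the least moved one goes to a smaller and hence fixed
        index, against injectivity.\<close>
      define D where "D = {i. p i \<noteq> i}"
      have "D \<noteq> {}" using p by (auto simp: D_def)
      then have min: "Min D \<in> D" "\<And>i. i \<in> D \<Longrightarrow> Min D \<le> i" by auto
      have "p (Min D) < Min D" using le[of "Min D"] min(1) by (auto simp: D_def)
      then have "p (Min D) \<notin> D" using min(2)[of "p (Min D)"] by (auto simp: not_le[symmetric])
      then have "p (p (Min D)) = p (Min D)" by (simp add: D_def)
      then have "p (Min D) = Min D" using permutes_inj[OF p(1)] by (auto dest: injD)
      then show False using min(1) by (simp add: D_def)
    qed
    then obtain i where "i < p i" by blast
    then show ?thesis using assms by (intro prod_zero) auto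
  qed
  then have "det A = (\<Sum>p\<in>{id}. of_int (sign p) * (\<Prod>i\<in>UNIV. A $ i $ p i))"
    unfolding det_def by (intro sum.mono_neutral_right) (auto simp: permutes_id)
  then show ?thesis by simp
qed

text \<open>On the hyperplane row \<open>i\<close> becomes \<open>e\<close> times row
  \<open>j\<close>: a zero row for \<open>e = 0\<close>, two proportional rows otherwise.\<close>

lemma lin_dvd_det:
  fixes B :: "(('n::{finite,linorder} cpoly, 'n) vec, 'n) vec"
  assumes h: "normal_hp (i, e, j, k)"
    and r: "\<And>r. lin (i, e, j, k) dvd B $ i $ r - Const e * B $ j $ r"
  shows "lin (i, e, j, k) dvd det B"
proof -
  let ?h = "(i, e, j, k)"
  define C where "C = (\<chi> a r. restrict_to ?h (B $ a $ r))"
  have "C $ i $ r = Const e * C $ j $ r" for r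
    using r[of r] by (simp add: C_def lin_dvd_iff[OF h] restrict_to_simps)
  then have C: "C = (\<chi> a. if a = i then Const e *s (C $ j) else C $ a)"
    by (simp add: vec_eq_iff)
  have d: "det C = Const e * det (\<chi> a. if a = i then C $ j else C $ a)"
    by (subst C) (rule det_row_mul)
  have "det C = 0"
  proof (cases "e = 0")
    case False
    then have "i \<noteq> j" using h by (auto simp: normal_hp_def)
    then have "det (\<chi> a. if a = i then C $ j else C $ a) = 0"
      by (intro det_identical_rows[of i j]) (simp_all add: row_def vec_eq_iff)
    then show ?thesis using d by simp
  qed (simp add: d Const_hom)
  then show ?thesis
    by (simp add: lin_dvd_iff[OF h] cpoly_hom_det[OF cpoly_hom_restrict_to] C_def)
qed

section \<open>Saito's criterion\<close>

definition log_der :: "'n hyperplane set \<Rightarrow> 'n::finite pmap set"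
  where "log_der H = {L \<in> derivations. \<forall>h\<in>H. lin h dvd L (lin h)}"

lemma log_der_det:
  fixes L :: "'n::{finite,linorder} \<Rightarrow> 'n pmap"
  assumes "finite H" "\<And>h. h \<in> H \<Longrightarrow> normal_hp h" "\<And>r. L r \<in> log_der H"
  shows "(\<Prod>h\<in>H. lin h) dvd det (\<chi> i r. L r (X i))"
proof (rule prod_lin_dvd)
  fix h assume h: "h \<in> H"
  obtain i e j k where hh: "h = (i, e, j, k)" by (cases h)
  show "lin h dvd det (\<chi> i r. L r (X i))"
    unfolding hh
  proof (rule lin_dvd_det)
    show "normal_hp (i, e, j, k)" using assms(2)[OF h] by (simp add: hh)
    fix r
    have "L r \<in> derivations" "lin h dvd L r (lin h)" using assms(3)[of r] h by (auto simp: log_der_def)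
    then show "lin (i, e, j, k) dvd (\<chi> i r. L r (X i)) $ i $ r - Const e * (\<chi> i r. L r (X i)) $ j $ r"
      by (simp add: hh derivation_lin)
  qed
qed (use assms in auto)

lemma log_der_comb:
  assumes "\<And>r. r \<in> A \<Longrightarrow> L r \<in> log_der H"
  shows "(\<Sum>r\<in>A. der_scale (g r) (L r)) \<in> log_der H"
  using assms by (auto simp: log_der_def der_comb_apply intro!: derivation_comb dvd_sum dvd_mult)

text \<open>Replacing column \<open>r\<close> by \<open>D\<close> gives a determinant that all the
  forms divide again. By Cramer's rule its quotient by their product is, up to the scalar
  \<open>c\<close>, the coefficient of \<open>L r\<close>.\<close>

lemma saito_span:
  fixes L :: "'n::{finite,linorder} \<Rightarrow> 'n pmap"
  assumes H: "finite H" "\<And>h. h \<in> H \<Longrightarrow> normal_hp h" and L: "\<And>r. L r \<in> log_der H"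
    and det: "det (\<chi> i r. L r (X i)) = Const c * (\<Prod>h\<in>H. lin h)" "c \<noteq> 0"
    and D: "D \<in> log_der H"
  shows "\<exists>g. D = (\<Sum>r\<in>UNIV. der_scale (g r) (L r))"
proof -
  define Q where "Q = (\<Prod>h\<in>H. lin h)"
  have Q: "Q \<noteq> 0" unfolding Q_def prod_zero_iff[OF H(1)] using H(2) lin_nonzero by blast
  have "Q dvd det (\<chi> i j. (if j = r then D else L j) (X i))" for r
    unfolding Q_def by (rule log_der_det) (use H L D in auto)
  then have "\<forall>r. \<exists>u. det (\<chi> i j. (if j = r then D else L j) (X i)) = Q * u"
    by (auto simp: dvd_def)
  then obtain u where u: "\<And>r. det (\<chi> i j. (if j = r then D else L j) (X i)) = Q * u r" by metis
  have if_app: "(if j = r then D else L j) f = (if j = r then D f else L j f)" for j r f by simp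
  have "D (X i) = (\<Sum>r\<in>UNIV. Const (1 / c) * u r * L r (X i))" for i
  proof -
    have "det (\<chi> i r. L r (X i)) \<noteq> 0" using Q det by (simp add: Q_def)
    from cramer_idom[OF this, of "\<lambda>i. D (X i)" i]
    have "Const c * Q * D (X i) = (\<Sum>r\<in>UNIV. Q * u r * L r (X i))"
      unfolding det(1) vec_lambda_beta u[unfolded if_app] Q_def[symmetric] .
    also have "\<dots> = Q * (\<Sum>r\<in>UNIV. u r * L r (X i))" by (simp add: sum_distrib_left mult.assoc)
    finally have "Q * (Const c * D (X i)) = Q * (\<Sum>r\<in>UNIV. u r * L r (X i))" by (simp only: mult_ac)
    then have "Const (1 / c) * (Const c * D (X i)) = Const (1 / c) * (\<Sum>r\<in>UNIV. u r * L r (X i))"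
      using Q by simp
    moreover have "Const (1 / c) * Const c = (1 :: 'n cpoly)"
      using det(2) by (simp add: Const_hom flip: Const_hom(3))
    ultimately show ?thesis by (simp add: sum_distrib_left mult.assoc[symmetric])
  qed
  then have "D = (\<Sum>r\<in>UNIV. der_scale (Const (1 / c) * u r) (L r))"
    using D L by (intro derivations_eqI derivation_comb) (auto simp: log_der_def der_comb_apply)
  then show ?thesis by (rule exI[of _ "\<lambda>r. Const (1 / c) * u r"])
qed

lemma saito_independent:
  fixes L :: "'n::{finite,linorder} \<Rightarrow> 'n pmap"
  assumes "det (\<chi> i r. L r (X i)) \<noteq> 0" "(\<Sum>r\<in>UNIV. der_scale (g r) (L r)) = 0"
  shows "g r = 0"
proof (rule det_nonzero_kernel[OF assms(1)])
  show "(\<Sum>r\<in>UNIV. g r * (\<chi> i r. L r (X i)) $ i $ r) = 0" for i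
    using arg_cong[OF assms(2), of "\<lambda>D. D (X i)"] by (simp add: der_comb_apply)
qed

section \<open>The extended Catalan arrangement\<close>

lemma prod_shifted_squares:
  fixes z :: "'a::comm_ring_1"
  shows "z * (\<Prod>k=1..n. z ^ 2 - of_nat k ^ 2) = pochhammer (z - of_nat n) (2 * n + 1)"
proof (induction n)
  case (Suc n)
  have "pochhammer (z - of_nat (Suc n)) (2 * Suc n + 1) =
    (z - of_nat (Suc n)) * (pochhammer (z - of_nat n) (2 * n + 1) * (z + of_nat (Suc n)))"
    unfolding mult_Suc_right add_2_eq_Suc add_Suc pochhammer_rec[of "z - of_nat (Suc n)"]
    unfolding pochhammer_Suc[of _ "Suc (2 * n)"] Suc_eq_plus1[symmetric]
    by (simp add: algebra_simps pochhammer_Suc)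
  also have "\<dots> = (z ^ 2 - of_nat (Suc n) ^ 2) * pochhammer (z - of_nat n) (2 * n + 1)"
    by (simp add: algebra_simps power2_eq_square)
  finally show ?case unfolding Suc.IH[symmetric] by (simp add: mult_ac)
qed simp

text \<open>\<open>h\<close> plays the part of one half in an arbitrary ring; each factor is 4 times
  the product of \<open>z - (j - h)\<close> and \<open>z + (j - h)\<close>.\<close>

lemma prod_half_shifted_squares:
  fixes z h :: "'a::comm_ring_1"
  assumes "2 * h = 1"
  shows "(\<Prod>j=1..n. 4 * z ^ 2 - (2 * of_nat j - 1) ^ 2) = 4 ^ n * pochhammer (z - (of_nat n - h)) (2 * n)"
proof (induction n)
  case (Suc n)
  have "pochhammer (z - (of_nat (Suc n) - h)) (2 * Suc n) =
    (z - (of_nat (Suc n) - h)) * (pochhammer (z - (of_nat n - h)) (2 * n) * (z + of_nat n + h))"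
    unfolding mult_Suc_right add_2_eq_Suc pochhammer_rec[of "z - (of_nat (Suc n) - h)"]
    unfolding pochhammer_Suc[of _ "2 * n"]
    by (simp add: algebra_simps)
  moreover have "4 * ((z - (of_nat (Suc n) - h)) * (z + of_nat n + h))
      = 4 * z ^ 2 - (2 * of_nat (Suc n) - 1) ^ 2"
  proof -
    have "2 * (z - (of_nat (Suc n) - h)) = 2 * z - 2 * of_nat (Suc n) + 2 * h"
      "2 * (z + of_nat n + h) = 2 * z + 2 * of_nat n + 2 * h" by (simp_all add: algebra_simps)
    moreover have "4 * ((z - (of_nat (Suc n) - h)) * (z + of_nat n + h))
        = (2 * (z - (of_nat (Suc n) - h))) * (2 * (z + of_nat n + h))"
      by (simp only: mult_ac) simp
    ultimately have "4 * ((z - (of_nat (Suc n) - h)) * (z + of_nat n + h))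
        = (2 * z - 2 * of_nat (Suc n) + 1) * (2 * z + 2 * of_nat n + 1)"
      by (simp only: assms)
    then show ?thesis by (simp only:) (simp add: algebra_simps power2_eq_square)
  qed
  ultimately have R: "4 * pochhammer (z - (of_nat (Suc n) - h)) (2 * Suc n) =
     (4 * z ^ 2 - (2 * of_nat (Suc n) - 1) ^ 2) * pochhammer (z - (of_nat n - h)) (2 * n)"
    by (metis mult.assoc mult.commute)
  have "(\<Prod>j=1..Suc n. 4 * z ^ 2 - (2 * of_nat j - 1) ^ 2) =
    (\<Prod>j=1..n. 4 * z ^ 2 - (2 * of_nat j - 1) ^ 2) * (4 * z ^ 2 - (2 * of_nat (Suc n) - 1) ^ 2)"
    by simp
  also have "\<dots> = 4 ^ n * ((4 * z ^ 2 - (2 * of_nat (Suc n) - 1) ^ 2)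
      * pochhammer (z - (of_nat n - h)) (2 * n))"
    unfolding Suc.IH by (simp only: mult_ac)
  also have "\<dots> = 4 ^ Suc n * pochhammer (z - (of_nat (Suc n) - h)) (2 * Suc n)"
    unfolding R[symmetric] by (simp only: power_Suc mult_ac)
  finally show ?case .
qed simp

section \<open>Ranks of indices and counting of pairs\<close>

lemma card_strict_pairs:
  "2 * card {(i, j). i < (j :: 'n::{finite,linorder})} + CARD('n) = CARD('n) * CARD('n)"
proof -
  have "card {(i, j). j < (i :: 'n)} = card (prod.swap ` {(i, j). i < (j :: 'n)})"
    by (rule arg_cong[of _ _ card]) (auto simp: image_def)
  then have s: "card {(i, j). j < (i :: 'n)} = card {(i, j). i < (j :: 'n)}"
    by (simp add: card_image)
  have d: "card {(i, j). i = (j :: 'n)} = CARD('n)"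
  proof -
    have "{(i, j). i = (j :: 'n)} = (\<lambda>i. (i, i)) ` UNIV" by auto
    then show ?thesis by (simp add: card_image inj_on_def)
  qed
  have "card (UNIV :: ('n \<times> 'n) set)
      = card (({(i, j). i < (j :: 'n)} \<union> {(i, j). j < i}) \<union> {(i, j). i = j})"
    by (rule arg_cong[of _ _ card]) auto
  also have "\<dots> = card ({(i, j). i < (j :: 'n)} \<union> {(i, j). j < i}) + card {(i, j). i = (j :: 'n)}"
    by (rule card_Un_disjoint) auto
  also have "card ({(i, j). i < (j :: 'n)} \<union> {(i, j). j < i})
      = card {(i, j). i < (j :: 'n)} + card {(i, j). j < (i :: 'n)}"
    by (rule card_Un_disjoint) auto
  finally show ?thesis using s d by (simp add: card_prod)
qed

text \<open>The rank of an index, counted from 0. Ranks serve as degrees of the test polynomials and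
  fix the evaluation point.\<close>

definition pos :: "'n::{finite,linorder} \<Rightarrow> nat"
  where "pos i = card {j. j < i}"

lemma pos_less: "i < j \<Longrightarrow> pos i < pos j"
  unfolding pos_def by (intro psubset_card_mono) auto

lemma inj_pos: "inj pos"
  by (rule linorder_injI) (metis pos_less less_irrefl)

lemma pos_image: "pos ` {j. j < i} = {..<pos i}"
proof (rule card_subset_eq)
  show "card (pos ` {j. j < i}) = card {..<pos i}"
    using inj_pos by (subst card_image) (auto simp: pos_def inj_on_def)
qed (auto simp: pos_less)

lemma sum_pos: "(\<Sum>j | j < i. f (pos j)) = (\<Sum>n<pos i. f n)"
  unfolding pos_image[symmetric] using inj_pos by (subst sum.reindex) (auto intro: inj_on_subset)

lemma sum_pos_UNIV: "(\<Sum>i\<in>UNIV. pos (i :: 'n)) = card {(i, j). i < (j :: 'n::{finite,linorder})}"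
proof -
  have "{(i, j). i < (j :: 'n)} = prod.swap ` (SIGMA j:UNIV. {i. i < j})" by force
  then have "card {(i, j). i < (j :: 'n)} = card (SIGMA j:(UNIV :: 'n set). {i. i < j})"
    by (simp add: card_image)
  then show ?thesis by (simp add: pos_def)
qed

lemma image_mset_sum: "image_mset f (\<Sum>a\<in>A. g a) = (\<Sum>a\<in>A. image_mset f (g a))"
  by (induction A rule: infinite_finite_induct) simp_all

lemma size_sum_multiset:
  fixes g :: "'a \<Rightarrow> 'b multiset"
  shows "size (\<Sum>a\<in>A. g a) = (\<Sum>a\<in>A. size (g a))"
  by (induction A rule: infinite_finite_induct) simp_all

lemma in_sum_multisetD:
  fixes g :: "'a \<Rightarrow> 'b multiset"
  shows "b \<in># (\<Sum>a\<in>A. g a) \<Longrightarrow> \<exists>a\<in>A. b \<in># g a"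
  by (induction A rule: infinite_finite_induct) auto

section \<open>The hyperplanes and the defining polynomial\<close>

context multiplicities
begin

definition hyps :: "'n::{finite,linorder} hyperplane set"
  where "hyps = ((\<lambda>(i, n). (i, 0, i, of_nat m1 - of_nat n)) ` (UNIV \<times> {..<2 * m1 + 1}) \<union>
     (\<lambda>(i, n). (i, 0, i, h2 - of_nat n)) ` (UNIV \<times> {..<2 * m2})) \<union>
     (\<lambda>((i, j), e, n). (i, e, j, of_nat m - of_nat n)) ` ({(i, j). i < j} \<times> {1, -1} \<times> {..<2 * m + 1})"

lemma normal_hyps: "h \<in> hyps \<Longrightarrow> normal_hp h"
  by (auto simp: hyps_def normal_hp_def)

lemma finite_hyps: "finite hyps"
  unfolding hyps_def by (intro finite_UnI finite_imageI finite_cartesian_product) auto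

text \<open>Keeps integral and half-integral levels apart, so that no axial hyperplane is counted
  twice.\<close>

lemma half_integer: "of_nat m1 - of_nat n \<noteq> h2 - of_nat k"
proof
  assume "of_nat m1 - of_nat n = h2 - of_nat k"
  then have "Re (2 * (of_nat m1 - of_nat n)) = Re (2 * (h2 - of_nat k))" by simp
  then have "real_of_int (2 * (int m1 - int n - int m2 + int k) + 1) = of_int 0"
    by (simp add: h2_def)
  then show False unfolding of_int_eq_iff by presburger
qed

text \<open>With \<open>F\<close> arbitrary, one computation yields the product of the forms and,
  for the constant 2, the number of hyperplanes as an exponent.\<close>

lemma prod_hyps:
  fixes F :: "'n::{finite,linorder} hyperplane \<Rightarrow> 'b::comm_monoid_mult"
  shows "(\<Prod>h\<in>hyps. F h) =
    (\<Prod>i\<in>UNIV. (\<Prod>n<2 * m1 + 1. F (i, 0, i, of_nat m1 - of_nat n)) * (\<Prod>n<2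
        * m2. F (i, 0, i, h2 - of_nat n))) *
    (\<Prod>(i, j)\<in>{(i, j). i < j}. \<Prod>e\<in>{1, -1}. \<Prod>n<2 * m + 1. F (i, e, j, of_nat m - of_nat n))"
proof -
  define f1 f2 f3 where "f1 = (\<lambda>(i :: 'n, n). (i, 0 :: complex, i, of_nat m1 - of_nat n :: complex))"
    and "f2 = (\<lambda>(i :: 'n, n). (i, 0 :: complex, i, h2 - of_nat n))"
    and "f3 = (\<lambda>((i :: 'n, j :: 'n), e :: complex, n). (i, e, j, of_nat m - of_nat n :: complex))"
  define A1 A2 A3 where "A1 = (UNIV :: 'n set) \<times> {..<2 * m1 + 1}" and "A2
      = (UNIV :: 'n set) \<times> {..<2 * m2}"
    and "A3 = {(i, j). i < (j :: 'n)} \<times> {1 :: complex, -1} \<times> {..<2 * m + 1}"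
  have fin: "finite A1" "finite A2" "finite A3" unfolding A1_def A2_def A3_def by auto
  have inj: "inj_on f1 A1" "inj_on f2 A2" "inj_on f3 A3"
    by (auto simp: inj_on_def f1_def f2_def f3_def)
  have d1: "f1 ` A1 \<inter> f2 ` A2 = {}" using half_integer by (auto simp: f1_def f2_def)
  have d2: "(f1 ` A1 \<union> f2 ` A2) \<inter> f3 ` A3 = {}" by (auto simp: f1_def f2_def f3_def A3_def)
  have h: "hyps = (f1 ` A1 \<union> f2 ` A2) \<union> f3 ` A3"
    by (simp add: hyps_def f1_def f2_def f3_def A1_def A2_def A3_def)
  have "(\<Prod>h\<in>hyps. F h) = (\<Prod>a\<in>A1. F (f1 a)) * (\<Prod>a\<in>A2. F (f2 a)) * (\<Prod>a\<in>A3. F (f3 a))"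
    unfolding h using fin
    by (simp add: prod.union_disjoint d1 d2 prod.reindex[OF inj(1)] prod.reindex[OF inj(2)]
        prod.reindex[OF inj(3)])
  moreover have "(\<Prod>a\<in>A1. F (f1 a)) = (\<Prod>i\<in>UNIV. \<Prod>n<2 * m1 + 1. F (i, 0, i, of_nat m1 - of_nat n))"
    unfolding A1_def prod.cartesian_product by (rule prod.cong) (auto simp: f1_def)
  moreover have "(\<Prod>a\<in>A2. F (f2 a)) = (\<Prod>i\<in>UNIV. \<Prod>n<2 * m2. F (i, 0, i, h2 - of_nat n))"
    unfolding A2_def prod.cartesian_product by (rule prod.cong) (auto simp: f2_def)
  moreover have "(\<Prod>a\<in>A3. F (f3 a))
      = (\<Prod>(i, j)\<in>{(i, j). i < j}. \<Prod>e\<in>{1, -1}. \<Prod>n<2 * m + 1. F (i, e, j, of_nat m - of_nat n))"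
  proof -
    have "(\<Prod>a\<in>A3. F (f3 a)) = (\<Prod>p\<in>{(i, j). i < (j :: 'n)}. \<Prod>e\<in>{1, -1}. \<Prod>n<2 * m + 1. F (f3 (p, e, n)))"
      unfolding A3_def prod.cartesian_product by (rule prod.cong) auto
    then show ?thesis by (simp add: f3_def case_prod_unfold)
  qed
  ultimately show ?thesis by (simp only: prod.distrib)
qed

lemma card_hyps:
  "card (hyps :: 'n hyperplane set) =
    CARD('n::{finite,linorder}) * (2 * m1 + 1 + 2 * m2) + card {(i, j). i < (j :: 'n)} * (2 * (2 * m
        + 1))"
proof -
  have four: "(4 :: nat) ^ k = 2 ^ (2 * k)" for k
    by (simp add: power_mult)
  have "(2 :: nat) ^ card (hyps :: 'n hyperplane set) = (\<Prod>h\<in>(hyps :: 'n hyperplane set). 2)" by simp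
  also have "\<dots> = 2 ^ (CARD('n) * (2 * m1 + 1 + 2 * m2) + card {(i, j). i < (j :: 'n)} * (2 * (2 * m
      + 1)))"
    unfolding prod_hyps
    by (simp add: case_prod_unfold four algebra_simps flip: power_mult power_add mult_2)
  finally show ?thesis by simp
qed

lemma prod_lin_pochhammer:
  "(\<Prod>n<k. lin (i, e, j, c - of_nat n)) = pochhammer (X i - Const e * X j - Const c) k"
  by (simp add: pochhammer_prod lin_def Const_minus Const_of_nat algebra_simps atLeast0LessThan)

text \<open>The scalar collects one factor 4 for each opposite pair of half-integral levels on each
  axis.\<close>

lemma BCCat_poly_eq:
  "(BCCat_poly m1 m2 m :: 'n::{finite,linorder} cpoly) = Const ((4 ^ m2) ^ CARD('n)) * (\<Prod>h\<in>hyps. lin h)"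
proof -
  have half: "2 * Const (1 / 2) = (1 :: 'n cpoly)"
    by (simp add: Const_hom flip: Const_numeral Const_hom(3))
  have h2: "Const h2 = of_nat m2 - Const (1 / 2)" by (simp add: h2_def Const_minus Const_of_nat)
  have c4: "Const (c ^ k) = Const c ^ k" for c k by (induction k) (simp_all add: Const_hom)
  have ax: "X i * (\<Prod>j=1..m1. X i ^ 2 - of_nat j ^ 2) * (\<Prod>j=1..m2. 4 * X i ^ 2 - (2 * of_nat j - 1) ^ 2)
    = Const (4 ^ m2) * ((\<Prod>n<2 * m1 + 1. lin (i, 0, i, of_nat m1 - of_nat n)) * (\<Prod>n<2
        * m2. lin (i, 0, i, h2 - of_nat n)))" for i :: 'n
    unfolding prod_shifted_squares prod_half_shifted_squares[OF half] prod_lin_pochhammer h2 c4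
    by (simp add: Const_hom Const_of_nat Const_numeral mult_ac)
  have pr: "(\<Prod>\<epsilon>\<in>{1, -1}. (X i - \<epsilon> * X j) * (\<Prod>k=1..m. (X i - \<epsilon> * X j) ^ 2 - of_nat k ^ 2)) =
    (\<Prod>e\<in>{1, -1}. \<Prod>n<2 * m + 1. lin (i, e, j, of_nat m - of_nat n))" for i j :: 'n
  proof -
    have "(1 :: 'n cpoly) \<noteq> -1" "(1 :: complex) \<noteq> -1" by (simp_all add: eq_neg_iff_add_eq_0)
    then show ?thesis
      unfolding prod_shifted_squares prod_lin_pochhammer
          by (simp add: Const_hom Const_of_nat Const_minus)
  qed
  show ?thesis
    unfolding BCCat_poly_def prod_hyps ax pr by (simp only: prod.distrib prod_constant c4 mult_ac)
qed

text \<open>A divisor of total degree 1 is a scalar multiple of one of the forms, so testing all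
  such divisors amounts to testing the normal forms.\<close>

lemma D_BCCat_eq: "D_BCCat m1 m2 m = log_der (hyps :: 'n::{finite,linorder} hyperplane set)"
proof -
  have P0: "(4 ^ m2) ^ CARD('n) \<noteq> (0 :: complex)" by simp
  have 1: "lin h dvd BCCat_poly m1 m2 m" if "h \<in> hyps" for h :: "'n hyperplane"
    unfolding BCCat_poly_eq using that finite_hyps by (intro dvd_mult dvd_prodI)
  have 2: "l dvd L l" if L: "L \<in> derivations" "\<And>h. h \<in> hyps \<Longrightarrow> lin h dvd L (lin h)"
    and l: "total_degree l = 1" "l dvd BCCat_poly m1 m2 m" for L and l :: "'n cpoly"
  proof -
    obtain g where "l * g = Const ((4 ^ m2) ^ CARD('n)) * (\<Prod>h\<in>hyps. lin h)"
      using l(2) unfolding BCCat_poly_eq by (metis dvdE)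
    then obtain h u where h: "h \<in> hyps" "l = Const u * lin h"
      using deg_1_dvd_prod_lin[OF finite_hyps normal_hyps P0 deg_eq_1[OF l(1)]] by blast
    then show ?thesis using L by (simp add: derivationsD mult_dvd_mono)
  qed
  show ?thesis
    unfolding D_BCCat_def log_der_def using 1 2 total_degree_lin[OF normal_hyps] by blast
qed

section \<open>The basic derivations\<close>

text \<open>The roots of the test polynomial of degree \<open>r\<close>. The spacing
  \<open>m + 1\<close> leaves room for the \<open>m\<close> roots of one \<open>beta\<close> between
  neighbours, which the determinant evaluation exploits.\<close>

definition nodes :: "nat \<Rightarrow> 'n cpoly multiset"
  where "nodes r = (\<Sum>n<r. {#tau ((m + 1) * n)#})"

definition basic :: "'n::{finite,linorder} \<Rightarrow> 'n \<Rightarrow> 'n cpoly"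
  where "basic r i = lam (X i) (nodes (pos r) + (\<Sum>l\<in>UNIV - {i}. beta (X l)))"

lemma image_nodes: "cpoly_hom \<psi> \<Longrightarrow> image_mset \<psi> (nodes r) = nodes r"
  by (simp add: nodes_def image_mset_sum tau_def cpoly_homD)

lemma basic_hom:
  assumes "cpoly_hom \<psi>"
  shows "\<psi> (basic r i) = lam (\<psi> (X i)) (nodes (pos r) + (\<Sum>l\<in>UNIV - {i}. beta (\<psi> (X l))))"
  by (simp add: basic_def lam_hom[OF assms] image_mset_sum image_nodes[OF assms] beta_hom[OF assms])

text \<open>For \<open>e = 0\<close> a factor of \<open>axial\<close> vanishes on the hyperplane. On
  \<open>x_i = e x_j + k\<close> the two values are related by \<open>lam_exchange\<close> with
  \<open>w = e x_j\<close>; the sign \<open>e\<close> is absorbed because \<open>lam\<close> is odd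
  and \<open>beta\<close> even.\<close>

lemma basic_log_der: "der_of (basic r) \<in> log_der hyps"
  unfolding log_der_def
proof (intro CollectI conjI ballI der_of_derivation)
  fix h :: "'a hyperplane" assume h: "h \<in> hyps"
  obtain i e j k where hh: "h = (i, e, j, k)" by (cases h)
  note n = normal_hyps[OF h, unfolded hh]
  define \<psi> where "\<psi> = restrict_to (i, e, j, k)"
  have hom: "cpoly_hom \<psi>" by (simp add: \<psi>_def cpoly_hom_restrict_to)
  have X: "\<psi> (X i) = Const e * X j + Const k" "\<And>l. l \<noteq> i \<Longrightarrow> \<psi> (X l) = X l"
    by (simp_all add: \<psi>_def restrict_to_def)
  have "\<psi> (basic r i) = Const e * \<psi> (basic r j)"
  proof (cases "e = 0")
    case True
    then have "axial (Const k) = (0 :: 'a cpoly)"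
    proof -
      have z: "pochhammer (Const c - Const d) q = (0 :: 'a cpoly)" if "c = d - of_nat p" "p < q"
          for c d p q
      proof -
        have "Const c - Const d + of_nat p = (0 :: 'a cpoly)"
          using that by (simp add: Const_minus Const_of_nat)
        then show ?thesis using that unfolding pochhammer_prod by (intro prod_zero) auto
      qed
      show ?thesis using h True unfolding hh hyps_def axial_def
        by (auto intro: z)
    qed
    then show ?thesis using True by (simp add: basic_hom[OF hom] X lam_def Const_hom)
  next
    case False
    then obtain q where e: "e \<in> {1, -1}" and ij: "i < j" and k: "k = of_nat m - of_nat q" "q < 2 * m + 1"
      using h by (auto simp: hh hyps_def)
    define N where "N = nodes (pos r) + (\<Sum>l\<in>UNIV - {i} - {j}. beta (X l))"
    define w where "w = Const e * X j"
    have K: "Const k = (of_int (int m - int q) :: 'a cpoly)"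
      using k by (simp add: Const_minus Const_of_nat)
    have bw: "beta w = beta (X j)" and lw: "lam w M = Const e * lam (X j) M" for M
      using e by (auto simp: w_def Const_hom Const_minus beta_neg lam_neg)
    have s: "(\<Sum>l\<in>UNIV - {i}. beta (\<psi> (X l))) = (\<Sum>l\<in>UNIV - {i} - {j}. beta (X l)) + beta (X j)"
      "(\<Sum>l\<in>UNIV - {j}. beta (\<psi> (X l))) = (\<Sum>l\<in>UNIV - {i} - {j}. beta (X l)) + beta (w + Const k)"
    proof -
      have "(\<Sum>l\<in>UNIV - {i} - {j}. beta (\<psi> (X l))) = (\<Sum>l\<in>UNIV - {i} - {j}. beta (X l))"
        by (intro sum.cong) (auto simp: X)
      moreover have "UNIV - {j} - {i} = UNIV - {i} - {j}" by auto
      ultimately show "(\<Sum>l\<in>UNIV - {i}. beta (\<psi> (X l))) = (\<Sum>l\<in>UNIV - {i} - {j}. beta (X l)) + beta (X j)"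
        "(\<Sum>l\<in>UNIV - {j}. beta (\<psi> (X l))) = (\<Sum>l\<in>UNIV - {i} - {j}. beta (X l)) + beta (w + Const k)"
        using ij sum.remove[of "UNIV - {i}" j "\<lambda>l. beta (\<psi> (X l))"] sum.remove[of "UNIV - {j}" i
            "\<lambda>l. beta (\<psi> (X l))"]
        by (auto simp: X w_def add.commute)
    qed
    have "\<psi> (basic r i) = lam (w + Const k) (N + beta w)"
      by (simp only: basic_hom[OF hom] s X(1) N_def bw w_def[symmetric] add.assoc)
    \<comment> \<open>The level \<open>k\<close> is an integer with absolute value at most
      \<open>m\<close>, exactly the range of the exchange identity.\<close>
    also have "\<dots> = lam w (N + beta (w + Const k))"
      unfolding K using k(2) by (intro lam_exchange[of _ _ "int m - int q"]) auto
    also have "\<dots> = Const e * \<psi> (basic r j)"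
      by (simp only: lw basic_hom[OF hom] X(2)[OF order.strict_implies_not_eq[OF ij, symmetric]]
        s N_def add.assoc)
    finally show ?thesis .
  qed
  then show "lin h dvd der_of (basic r) (lin h)"
    unfolding hh derivation_lin[OF der_of_derivation] lin_dvd_iff[OF n] \<psi>_def[symmetric]
    by (simp add: cpoly_homD[OF hom])
qed

lemma deg_basic:
  "deg (basic r (i :: 'n::{finite,linorder})) \<le> 2 * m1 + 2 * m2 + 1 + 2 * (pos r + (CARD('n) - 1) * m)"
proof -
  have "deg a \<le> 2" if a: "a \<in># nodes (pos r) + (\<Sum>l\<in>UNIV - {i}. beta (X l))" for a
  proof (cases "a \<in># nodes (pos r)")
    case True
    then show ?thesis by (auto simp: nodes_def tau_def dest!: in_sum_multisetD)
  next
    case False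
    then have "a \<in># (\<Sum>l\<in>UNIV - {i}. beta (X l))" using a by simp
    then show ?thesis by (auto dest!: in_sum_multisetD intro: deg_in_beta[rotated])
  qed
  moreover have "size (nodes (pos r) + (\<Sum>l\<in>UNIV - {i}. beta (X l)) :: 'n cpoly multiset)
      = pos r + (CARD('n) - 1) * m"
    by (simp add: nodes_def size_sum_multiset card_Diff_singleton)
  ultimately show ?thesis
    unfolding basic_def by (metis deg_lam deg_X order_refl)
qed

text \<open>Evaluation at the point \<open>p\<close> makes the matrix lower triangular with nonzero
  diagonal: \<open>lam_at_node\<close> applies to row \<open>i\<close> with
  \<open>J = (m + 1) * pos i\<close>.\<close>

lemma det_basic_nonzero: "det (\<chi> i r. basic r (i :: 'n::{finite,linorder})) \<noteq> 0"
proof -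
  \<comment> \<open>With steps of \<open>m + 1\<close>, the \<open>m\<close> roots of each
    \<open>beta (p l)\<close> fill exactly one gap between the nodes.\<close>
  define p where "p i = (of_nat (m1 + 1 + (m + 1) * pos i) :: 'n cpoly)" for i :: 'n
  define \<psi> where "\<psi> = subst p"
  have hom: "cpoly_hom \<psi>" by (simp add: \<psi>_def cpoly_hom_subst)
  have ev: "\<psi> (basic r i) = lam (p i) (nodes (pos r) + (\<Sum>l\<in>UNIV - {i}. beta (p l)))" for r i
    unfolding basic_hom[OF hom] by (simp add: \<psi>_def)
  have beta_p: "beta (p l) = squares (Const a3 + of_nat ((m + 1) * pos l + 1)) m" for l
  proof -
    have "p l - Const mu + 1 = Const a3 + of_nat ((m + 1) * pos l + 1)"
      using Const_consts(4)[where ?'n = 'n] by (simp add: p_def Const_of_nat algebra_simps)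
    then show ?thesis unfolding beta_def by (rule arg_cong)
  qed
  have blocks: "squares (Const a3 :: 'n cpoly) ((m + 1) * n)
      = (\<Sum>q<n. {#tau ((m + 1) * q)#} + squares (Const a3 + of_nat ((m + 1) * q + 1)) m)"
    for n
  proof (induction n)
    case (Suc n)
    have "tau ((m + 1) * n) = ((Const a3 + of_nat ((m + 1) * n)) ^ 2 :: 'n cpoly)"
      by (simp only: tau_def power2_eq_square Const_hom Const_of_nat)
    moreover have "(m + 1) * Suc n = (m + 1) * n + Suc m" by simp
    ultimately show ?case
      by (simp only: squares_add Suc sum.lessThan_Suc squares.simps) (simp add: add_ac)
  qed simp
  \<comment> \<open>The nodes of rank below \<open>pos i\<close> and the \<open>beta\<close> of
    smaller indices tile the first \<open>(m + 1) * pos i\<close> squares.\<close>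
  have low: "nodes (pos i) + (\<Sum>l | l < i. beta (p l)) = squares (Const a3) ((m + 1) * pos i)" for i
    unfolding beta_p sum_pos[of "\<lambda>k. squares (Const a3 + of_nat ((m + 1) * k
        + 1)) m"] blocks nodes_def sum.distrib ..
  have split: "(\<Sum>l\<in>UNIV - {i}. beta (p l)) = (\<Sum>l | l < i. beta (p l)) + (\<Sum>l | i < l. beta (p l))" for i
  proof -
    have "UNIV - {i} = {l. l < i} \<union> {l. i < l}" by auto
    moreover have "{l. l < i} \<inter> {l. i < l} = {}" by auto
    ultimately show ?thesis by (simp only:) (intro sum.union_disjoint; simp)
  qed
  \<comment> \<open>For \<open>i < r\<close> the node \<open>tau J\<close> that belongs to row
    \<open>i\<close> is itself a root of the test polynomial.\<close>
  have zero: "\<psi> (basic r i) = 0" if "i < r" for r i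
  proof -
    have "pos r = pos i + Suc (pos r - pos i - 1)" using pos_less[OF that] by simp
    moreover have "\<exists>M. nodes (n + Suc k) = nodes n + add_mset (tau ((m + 1) * n)) M" for n k
    proof (induction k)
      case (Suc k)
      have "nodes (n + Suc (Suc k)) = nodes (n + Suc k) + {#tau ((m + 1) * (n + Suc k))#}"
        unfolding nodes_def add_Suc_right[of n "Suc k"] sum.lessThan_Suc ..
      then show ?case using Suc.IH by (metis union_mset_add_mset_left union_assoc)
    qed (simp add: nodes_def)
    ultimately obtain M :: "'n cpoly multiset" where M: "nodes (pos r)
        = nodes (pos i) + add_mset (tau ((m + 1) * pos i)) M"
      by metis
    have "nodes (pos r) + (\<Sum>l\<in>UNIV - {i}. beta (p l)) =
      squares (Const a3) ((m + 1) * pos i) + add_mset (tau ((m + 1) * pos i)) (M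
          + (\<Sum>l | i < l. beta (p l)))"
      unfolding M split low[symmetric] by (simp add: add_ac)
    then show ?thesis unfolding ev by (simp only: lam_at_node(1)[OF p_def])
  qed
  \<comment> \<open>Only the \<open>beta\<close> of larger indices remain; their roots lie more than
    \<open>m\<close> places beyond \<open>tau J\<close>, where \<open>tau_inj\<close>
    applies.\<close>
  have nonzero: "\<psi> (basic i i) \<noteq> 0" for i
  proof -
    have "nodes (pos i) + (\<Sum>l\<in>UNIV - {i}. beta (p l)) =
      squares (Const a3) ((m + 1) * pos i) + (\<Sum>l | i < l. beta (p l))"
      unfolding split low[symmetric] by (simp add: add_ac)
    moreover have "a \<noteq> tau ((m + 1) * pos i)" if a: "a \<in># (\<Sum>l | i < l. beta (p l))" for a
    proof -
      obtain l where l: "i < l" "a \<in># beta (p l)" using in_sum_multisetD[OF a] by auto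
      then obtain q where "a = (Const a3 + of_nat ((m + 1) * pos l + 1) + of_nat q) ^ 2"
        unfolding beta_p in_squares_iff by blast
      then have "a = tau ((m + 1) * pos l + 1 + q)"
        by (simp add: tau_def power2_eq_square Const_hom Const_of_nat add_ac)
      moreover have "(m + 1) * pos l \<ge> (m + 1) * Suc (pos i)"
        using pos_less[OF l(1)] by (intro mult_le_mono) auto
      then have "(m + 1) * pos l + 1 + q \<ge> m + 1 + (m + 1) * pos i" by simp
      ultimately show ?thesis by (simp only: tau_inj not_False_eq_True)
    qed
    ultimately show ?thesis unfolding ev using lam_at_node(2)[OF p_def] by simp
  qed
  have "\<psi> (det (\<chi> i r. basic r i)) = (\<Prod>i\<in>UNIV. \<psi> (basic i i))"
    by (subst cpoly_hom_det[OF hom], subst det_triangular) (auto simp: zero)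
  moreover have "\<dots> \<noteq> 0" using nonzero by simp
  ultimately show ?thesis using cpoly_homD(4)[OF hom] by metis
qed

text \<open>All forms divide the nonzero determinant, whose degree is at most their number, so the
  quotient is a constant.\<close>

lemma det_basic: "\<exists>c. c \<noteq> 0 \<and> det (\<chi> i r. basic r (i :: 'n::{finite,linorder}))
    = Const c * (\<Prod>h\<in>hyps. lin h)"
proof -
  define Q where "Q = (\<Prod>h\<in>(hyps :: 'n hyperplane set). lin h)"
  have Q0: "Q \<noteq> 0"
    unfolding Q_def prod_zero_iff[OF finite_hyps] using lin_nonzero[OF normal_hyps] by blast
  have "deg Q = (\<Sum>h\<in>(hyps :: 'n hyperplane set). deg (lin h))"
    unfolding Q_def by (rule deg_prod_eq) (rule lin_nonzero[OF normal_hyps])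
  also have "\<dots> = (\<Sum>h\<in>(hyps :: 'n hyperplane set). 1)"
    by (intro sum.cong refl deg_lin normal_hyps)
  finally have dQ: "deg Q = card (hyps :: 'n hyperplane set)" by simp
  have "Q dvd det (\<chi> i r. basic r (i :: 'n))"
    using log_der_det[OF finite_hyps normal_hyps basic_log_der] by (simp add: Q_def)
  then obtain u where u: "det (\<chi> i r. basic r (i :: 'n)) = Q * u" by blast
  then have u0: "u \<noteq> 0" using det_basic_nonzero[where ?'n = 'n] by auto
  have "deg (det (\<chi> i r. basic r (i :: 'n))) \<le> card (hyps :: 'n hyperplane set)"
    unfolding det_def
  proof (rule deg_sum_le)
    fix \<pi> :: "'n \<Rightarrow> 'n" assume "\<pi> \<in> {\<pi>. \<pi> permutes UNIV}"
    then have \<pi>: "\<pi> permutes UNIV" by simp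
    define d where "d = 2 * m1 + 2 * m2 + 1 + 2 * ((CARD('n) - 1) * m)"
    have "deg (\<Prod>i\<in>UNIV. (\<chi> i r. basic r i) $ i $ \<pi> i) \<le> (\<Sum>i\<in>UNIV. d + 2 * pos (\<pi> i))"
    proof (rule deg_prod_le)
      show "deg ((\<chi> i r. basic r i) $ i $ \<pi> i) \<le> d + 2 * pos (\<pi> i)" for i
        using deg_basic[of "\<pi> i" i] by (simp add: d_def)
    qed
    also have "\<dots> = CARD('n) * d + 2 * (\<Sum>i\<in>UNIV. pos (\<pi> i))"
      by (simp add: sum.distrib sum_distrib_left)
    also have "(\<Sum>i\<in>UNIV. pos (\<pi> i)) = (\<Sum>i\<in>(UNIV :: 'n set). pos i)"
      using sum.permute[OF \<pi>, of pos] by simp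
    \<comment> \<open>Each pair of indices accounts for \<open>4 * m\<close> in the first term and 2
      in the ranks, matching its \<open>2 * (2 * m + 1)\<close> hyperplanes.\<close>
    also have "CARD('n) * d + 2 * (\<Sum>i\<in>(UNIV :: 'n set). pos i) = card (hyps :: 'n hyperplane set)"
    proof -
      have "CARD('n) * (CARD('n) - 1) = 2 * card {(i, j). i < (j :: 'n)}"
        using card_strict_pairs[where ?'n = 'n] by (simp add: diff_mult_distrib2)
      then have F: "CARD('n) * (2 * ((CARD('n) - 1) * m)) = card {(i, j). i < (j :: 'n)} * (2 * (2 * m))"
        by (metis (no_types, lifting) mult.assoc mult.commute)
      show ?thesis unfolding d_def card_hyps sum_pos_UNIV distrib_left F by simp
    qed
    finally have "deg (\<Prod>i\<in>UNIV. (\<chi> i r. basic r i) $ i $ \<pi> i) \<le> card (hyps :: 'n hyperplane set)" .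
    moreover have "deg (of_int (sign \<pi>) :: 'n cpoly) = 0" by (simp add: sign_def)
    ultimately show "deg (of_int (sign \<pi>) * (\<Prod>i\<in>UNIV. (\<chi> i r. basic r i) $ i $ \<pi> i))
        \<le> card (hyps :: 'n hyperplane set)"
      using deg_mult_le[of "of_int (sign \<pi>)" 0] by force
  qed
  then have "deg u = 0" using u deg_mult_eq[OF Q0 u0] dQ by simp
  then obtain c where "u = Const c" using deg_0_imp_Const by blast
  then show ?thesis using u u0 by (intro exI[of _ c]) (auto simp: Q_def mult.commute)
qed

end

section \<open>Invariance\<close>

lemma weyl_B_act_X:
  assumes "w \<in> weyl_B"
  obtains \<pi> \<epsilon> where "bij \<pi>" "\<And>i. \<epsilon> i \<in> {1, -1}" "\<And>i. act (inv w) (X i) = Const (\<epsilon> i) * X (\<pi> i)"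
    "\<And>i. act w (X (\<pi> i)) = Const (\<epsilon> i) * X i"
proof -
  obtain \<pi> \<epsilon> where p: "bij \<pi>" and e: "\<And>i. \<epsilon> i \<in> {1, -1}"
    and w: "w = (\<lambda>v. \<chi> i. \<epsilon> i * v $ \<pi> i)"
    using assms by (auto simp: weyl_B_def)
  have b: "bij w" using weyl_B_inv(1)[OF assms] .
  have aX: "act u (X i) = (\<Sum>j\<in>UNIV. Const (inv u (axis j 1) $ i) * X j)" for u i
    by (simp add: act_def insertion_X Const_hom)
  have "act (inv w) (X i) = (\<Sum>j\<in>UNIV. if j = \<pi> i then Const (\<epsilon> i) * X j else 0)" for i
    unfolding aX inv_inv_eq[OF b] by (intro sum.cong) (auto simp: w axis_def Const_hom)
  then have 1: "act (inv w) (X i) = Const (\<epsilon> i) * X (\<pi> i)" for i by simp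
  have "inv w (axis j 1) $ \<pi> i = (if j = i then \<epsilon> i else 0)" for i j
  proof -
    have "w (inv w (axis j 1)) = axis j 1" using b by (simp add: bij_is_surj surj_f_inv_f)
    then have "\<epsilon> i * inv w (axis j 1) $ \<pi> i = axis j 1 $ i" by (metis w vec_lambda_beta)
    then have "\<epsilon> i * (\<epsilon> i * inv w (axis j 1) $ \<pi> i) = \<epsilon> i * (axis j 1 $ i)" by simp
    moreover have "\<epsilon> i * (\<epsilon> i * y) = y" for y using e[of i] by auto
    ultimately show ?thesis by (simp add: axis_def)
  qed
  then have "act w (X (\<pi> i)) = (\<Sum>j\<in>UNIV. if j = i then Const (\<epsilon> i) * X j else 0)" for i
    unfolding aX by (intro sum.cong) (auto simp: Const_hom)
  then have 2: "act w (X (\<pi> i)) = Const (\<epsilon> i) * X i" for i by simp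
  show ?thesis using that[OF p e 1 2] .
qed

lemma act_act_inv:
  assumes "w \<in> weyl_B"
  shows "act w (act (inv w) f) = f"
proof -
  obtain \<pi> \<epsilon> where e: "\<And>i. \<epsilon> i \<in> {1, -1}" and a: "\<And>i. act (inv w) (X i) = Const (\<epsilon> i) * X (\<pi> i)"
    "\<And>i. act w (X (\<pi> i)) = Const (\<epsilon> i) * X i"
    using weyl_B_act_X[OF assms] by metis
  show ?thesis
  proof (induction f rule: cpoly_ring_induct)
    case (X i)
    have "Const (\<epsilon> i) * (Const (\<epsilon> i) * X i) = X i"
      using e[of i] by (auto simp: Const_hom Const_minus)
    then show ?case by (simp only: a act_hom)
  qed (simp_all add: act_hom)
qed

lemma der_act_derivation:
  assumes "L \<in> derivations" "w \<in> weyl_B"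
  shows "der_act w L \<in> derivations"
  unfolding derivations_def der_act_def
  by (simp add: act_hom derivationsD[OF assms(1)] act_act_inv[OF assms(2)])

lemma act_sum: "act w (\<Sum>a\<in>A. f a) = (\<Sum>a\<in>A. act w (f a))"
  by (rule cpoly_hom_sum[OF cpoly_hom_act])

lemma der_act_comb:
  "der_act w (\<Sum>r\<in>A. der_scale (g r) (L r)) = (\<Sum>r\<in>A. der_scale (act w (g r)) (der_act w (L r)))"
  by (rule ext) (simp add: der_act_def der_comb_apply act_sum act_hom)

context multiplicities
begin

text \<open>\<open>lam\<close> is odd in its point, \<open>beta\<close> is even, and the other
  indices enter only through an unordered sum of multisets, so signs and permutations
  cancel.\<close>

lemma der_act_basic:
  assumes "w \<in> weyl_B"
  shows "der_act w (der_of (basic r)) = der_of (basic r)"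
proof (rule derivations_eqI)
  show "der_act w (der_of (basic r)) \<in> derivations"
    by (intro der_act_derivation der_of_derivation assms)
  obtain \<pi> \<epsilon> where p: "bij \<pi>" and e: "\<And>i. \<epsilon> i \<in> {1, -1}"
    and a: "\<And>i. act (inv w) (X i) = Const (\<epsilon> i) * X (\<pi> i)" "\<And>i. act w (X (\<pi> i)) = Const (\<epsilon> i) * X i"
    using weyl_B_act_X[OF assms] by metis
  fix i
  have im: "\<pi> ` (UNIV - {i}) = UNIV - {\<pi> i}"
    using p by (simp add: image_set_diff bij_is_inj bij_is_surj)
  have "(\<Sum>l\<in>UNIV - {\<pi> i}. beta (act w (X l))) = (\<Sum>l\<in>UNIV - {i}. beta (act w (X (\<pi> l))))"
    unfolding im[symmetric] using p
    by (subst sum.reindex) (auto simp: bij_is_inj intro: inj_on_subset[of _ UNIV])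
  also have "\<dots> = (\<Sum>l\<in>UNIV - {i}. beta (X l))"
  proof (rule sum.cong)
    show "beta (act w (X (\<pi> l))) = beta (X l)" for l
      using e[of l] by (auto simp: a Const_hom Const_minus beta_neg)
  qed simp
  finally have s: "(\<Sum>l\<in>UNIV - {\<pi> i}. beta (act w (X l))) = (\<Sum>l\<in>UNIV - {i}. beta (X l))" .
  have "der_act w (der_of (basic r)) (X i) = Const (\<epsilon> i) * act w (basic r (\<pi> i))"
    by (simp add: der_act_def a derivationsD(3)[OF der_of_derivation] act_hom)
  also have "act w (basic r (\<pi> i))
      = lam (Const (\<epsilon> i) * X i) (nodes (pos r) + (\<Sum>l\<in>UNIV - {i}. beta (X l)))"
    unfolding basic_hom[OF cpoly_hom_act] a s ..
  also have "Const (\<epsilon> i) * \<dots> = basic r i"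
    using e[of i] by (auto simp: basic_def Const_hom Const_minus lam_neg)
  finally show "der_act w (der_of (basic r)) (X i) = der_of (basic r) (X i)" by simp
qed (rule der_of_derivation)

section \<open>Freeness of both modules\<close>

lemma det_der_of_basic: "det (\<chi> i r. der_of (basic r) (X i)) \<noteq> 0"
  using det_basic_nonzero by simp

lemma free_D_BCCat: "free_submodule der_scale (D_BCCat m1 m2 m :: 'n::{finite,linorder} pmap set)"
proof (rule free_submoduleI[OF module_der_scale, of "\<lambda>r. der_of (basic r)"])
  show "(\<Sum>r\<in>UNIV. der_scale (g r) (der_of (basic r))) = 0 \<Longrightarrow> g r = 0" for g and r :: 'n
    by (rule saito_independent[OF det_der_of_basic])
  obtain c where c: "c \<noteq> 0" "det (\<chi> i r. basic r (i :: 'n)) = Const c * (\<Prod>h\<in>hyps. lin h)"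
    using det_basic by blast
  show "D_BCCat m1 m2 m = range (\<lambda>g. \<Sum>r\<in>(UNIV :: 'n set). der_scale (g r) (der_of (basic r)))"
  proof
    show "D_BCCat m1 m2 m \<subseteq> range (\<lambda>g. \<Sum>r\<in>(UNIV :: 'n set). der_scale (g r) (der_of (basic r)))"
    proof
      fix D :: "'n pmap" assume "D \<in> D_BCCat m1 m2 m"
      then have D: "D \<in> log_der hyps" by (simp add: D_BCCat_eq)
      have "\<exists>g. D = (\<Sum>r\<in>(UNIV :: 'n set). der_scale (g r) (der_of (basic r)))"
        by (rule saito_span[OF finite_hyps normal_hyps basic_log_der _ c(1) D]) (simp_all add: c(2))
      then show "D \<in> range (\<lambda>g. \<Sum>r\<in>(UNIV :: 'n set). der_scale (g r) (der_of (basic r)))"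
        by (simp add: image_iff)
    qed
  qed (auto simp: D_BCCat_eq intro!: log_der_comb basic_log_der)
qed

text \<open>Applying \<open>w\<close> to the expansion of an invariant \<open>D\<close> in the
  invariant basis changes only the coefficients; their uniqueness makes them invariant.\<close>

lemma free_D_BCCat_W:
  "free_submodule der_scale_inv (D_BCCat_W m1 m2 m :: 'n::{finite,linorder} pmap set)"
proof (rule free_submoduleI[OF module_der_scale_inv, of "\<lambda>r. der_of (basic r)"])
  show "g r = 0" if "(\<Sum>r\<in>UNIV. der_scale_inv (g r) (der_of (basic r))) = 0" for g and r :: 'n
  proof -
    have "Rep_inv_cpoly (g r) = 0"
      using that unfolding der_scale_inv_def
      by (rule saito_independent[OF det_der_of_basic, where g = "\<lambda>r. Rep_inv_cpoly (g r)"])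
    then show ?thesis by (simp add: Rep_inv_cpoly_inject[symmetric] zero_inv_cpoly.rep_eq)
  qed
  show "D_BCCat_W m1 m2 m = range (\<lambda>g. \<Sum>r\<in>(UNIV :: 'n set). der_scale_inv (g r) (der_of (basic r)))"
  proof
    show "D_BCCat_W m1 m2 m \<subseteq> range (\<lambda>g. \<Sum>r\<in>(UNIV :: 'n set). der_scale_inv (g r) (der_of (basic r)))"
    proof
      fix D :: "'n pmap" assume DW: "D \<in> D_BCCat_W m1 m2 m"
      then have D: "D \<in> log_der hyps" and W: "\<And>w. w \<in> weyl_B \<Longrightarrow> der_act w D = D"
        by (auto simp: D_BCCat_W_def D_BCCat_eq)
      obtain c where c: "c \<noteq> 0" "det (\<chi> i r. basic r (i :: 'n)) = Const c * (\<Prod>h\<in>hyps. lin h)"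
        using det_basic by blast
      have "\<exists>g. D = (\<Sum>r\<in>(UNIV :: 'n set). der_scale (g r) (der_of (basic r)))"
        by (rule saito_span[OF finite_hyps normal_hyps basic_log_der _ c(1) D]) (simp_all add: c(2))
      then obtain g where g: "D = (\<Sum>r\<in>(UNIV :: 'n set). der_scale (g r) (der_of (basic r)))" by blast
      have "act w (g r) = g r" if w: "w \<in> weyl_B" for w r
      proof -
        have "(\<Sum>r\<in>(UNIV :: 'n set). der_scale (act w (g r)) (der_of (basic r))) = D"
          using W[OF w] unfolding g der_act_comb der_act_basic[OF w] .
        then have "(\<Sum>r\<in>(UNIV :: 'n set). der_scale (act w (g r)) (der_of (basic r))) -
            (\<Sum>r\<in>(UNIV :: 'n set). der_scale (g r) (der_of (basic r))) = 0"
          using g by simp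
        then have "(\<Sum>r\<in>(UNIV :: 'n set). der_scale (act w (g r) - g r) (der_of (basic r))) = 0"
          by (simp only: sum_subtractf[symmetric] module.scale_left_diff_distrib[OF module_der_scale])
        then have "act w (g r) - g r = 0"
          by (rule saito_independent[OF det_der_of_basic, where g = "\<lambda>r. act w (g r) - g r"])
        then show ?thesis by simp
      qed
      then have "Rep_inv_cpoly (Abs_inv_cpoly (g r)) = g r" for r
        by (intro Abs_inv_cpoly_inverse) auto
      then have "D = (\<Sum>r\<in>(UNIV :: 'n set). der_scale_inv (Abs_inv_cpoly (g r)) (der_of (basic r)))"
        by (simp add: g der_scale_inv_def)
      then show "D \<in> range (\<lambda>g. \<Sum>r\<in>(UNIV :: 'n set). der_scale_inv (g r) (der_of (basic r)))"
        by (rule range_eqI[where x = "\<lambda>r. Abs_inv_cpoly (g r)"])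
    qed
    show "range (\<lambda>g. \<Sum>r\<in>(UNIV :: 'n set). der_scale_inv (g r) (der_of (basic r))) \<subseteq> D_BCCat_W m1 m2 m"
    proof safe
      fix g :: "'n \<Rightarrow> 'n inv_cpoly"
      have "act w (Rep_inv_cpoly (g r)) = Rep_inv_cpoly (g r)" if "w \<in> weyl_B" for w r
        using Rep_inv_cpoly[of "g r"] that by auto
      then show "(\<Sum>r\<in>(UNIV :: 'n set). der_scale_inv (g r) (der_of (basic r))) \<in> D_BCCat_W m1 m2 m"
        by (auto simp: D_BCCat_W_def D_BCCat_eq der_scale_inv_def der_act_comb der_act_basic
            intro!: log_der_comb basic_log_der)
    qed
  qed
qed

end

theorem theorem5p12:
  fixes m\<^sub>1 m\<^sub>2 m\<^sub>3 :: nat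
  shows "free_submodule der_scale_inv (D_BCCat_W m\<^sub>1 m\<^sub>2 m\<^sub>3 :: 'n::{finite,linorder} pmap set) \<and>
    free_submodule der_scale (D_BCCat m\<^sub>1 m\<^sub>2 m\<^sub>3 :: 'n pmap set)"
  using multiplicities.free_D_BCCat_W multiplicities.free_D_BCCat by blast

end
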